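(* Let $n\ge1$ and $\varepsilon:[n]\to\{+,-\}$. Then the framing lattice $\mathscr L_{G_\varepsilon,F_\varepsilon}$ is isomorphic to the $\varepsilon$-Cambrian lattice.
   Context: A flow graph $G$ is a finite directed acyclic multigraph with linearly ordered vertices, edges directed from smaller to larger vertices, a unique source $s$ and unique sink $t$; a route is a directed $s$–$t$ path. A framing $F$ gives at each vertex $v$ linear orders $\le_{\mathrm{In}(v)}$, $\le_{\mathrm{Out}(v)}$ on entering and leaving edges. For a path $P$ through $v$, $Pv$ (resp. $vP$) is the maximal subpath of $P$ ending (resp. starting) at $v$. For $Pv,Qv$, let $w$ be the first vertex after which they coincide; if $w$ is the first vertex of one of them they are equal, else $Pv<_{\mathscr I(v)}Qv$ iff $P$'s edge entering $w$ precedes $Q$'s in $\le_{\mathrm{In}(w)}$. Dually for $vP,vQ$ with $w'$ the last vertex before which they coincide, using $\le_{\mathrm{Out}(w')}$, giving $<_{\mathscr O(v)}$. For paths $P,Q$ with common inner vertex $v$, $P<_v^{cw}Q$ means $Pv<_{\mathscr I(v)}Qv$ and $vQ<_{\mathscr O(v)}vP$; they are incoherent at $v$ if $P<_v^{cw}Q$ or $Q<_v^{cw}P$, coherent if incoherent at no common inner vertex. A clique is a set of pairwise coherent routes. For maximal cliques, $C\lessdot C'$ if $C'=(C\setminus\{R\})\cup\{R'\}$ with $R<_u^{cw}R'$ for some $u$; the framing lattice $\mathscr L_{G,F}$ is the set of maximal cliques with the reflexive-transitive closure of $\lessdot$. The Cambrian caracol graph $G_\varepsilon$ has vertices $s<0<1<\dots<n<t$,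 drawn in this order on a horizontal line, with horizontal edges $(s,0),(0,1),\dots,(n-1,n),(n,t)$ drawn on the line, and for each $a\in[n]$ two edges $(s,a)$ and $(a-1,t)$ drawn as arcs above the line if $\varepsilon(a)=+$ and below the line if $\varepsilon(a)=-$ (arcs on the same side nested without crossing). $F_\varepsilon$ is the framing induced by the drawing: at every vertex the incoming edges, and separately the outgoing edges, are ordered from top to bottom. Explicitly, at vertex $a\in[n]$: $(s,a)<_{\mathrm{In}(a)}(a-1,a)$ if $\varepsilon(a)=+$ and $(a-1,a)<_{\mathrm{In}(a)}(s,a)$ if $\varepsilon(a)=-$; at vertex $a-1$: $(a-1,t)<_{\mathrm{Out}(a-1)}(a-1,a)$ if $\varepsilon(a)=+$ and the reverse if $\varepsilon(a)=-$; at $s$ the outgoing edges are ordered: arcs above with endpoints decreasing, then $(s,0)$, then arcs below with endpoints increasing; at $t$ the incoming edges are ordered: arcs above with starting points increasing, then $(n,t)$, then arcs below with starting points decreasing. Let $P_\varepsilon(n)$ be a convex $(n+2)$-gon with vertices $0,1,\dots,n+1$ having strictly increasing $x$-coordinates, with $0$ and $n+1$ on a horizontal line and vertex $i\in[n]$ above this line if $\varepsilon(i)=+$ and below it if $\varepsilon(i)=-$. The $\varepsilon$-Cambrian lattice is the poset on triangulations of $P_\varepsilon(n)$ whose cover relations are increasing-slope diagonal flips (replacing a diagonal by the other diagonal of the quadrilateral formed by its two adjacent triangles, when the new diagonal has larger slope). *)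

theory Defs
  imports "HOL-Analysis.Analysis" "HOL-Library.Extended" "Graph_Theory.Kuratowski"
begin

section \<open>Framed flow graphs\<close>

locale flow_graph = fin_digraph G
  for G :: "('v::linorder, 'e) pre_digraph" +
  fixes s t :: 'v
  assumes arc_increasing: "e \<in> arcs G \<Longrightarrow> tail G e < head G e"
    and source_unique: "v \<in> verts G \<and> in_arcs G v = {} \<longleftrightarrow> v = s"
    and sink_unique: "v \<in> verts G \<and> out_arcs G v = {} \<longleftrightarrow> v = t"

record ('v, 'e) framing =
  In :: "'v \<Rightarrow> 'e rel"
  Out :: "'v \<Rightarrow> 'e rel"

locale framed_flow_graph = flow_graph +
  fixes F :: "('a, 'b) framing"
  assumes In_linear: "v \<in> verts G \<Longrightarrow> linear_order_on (in_arcs G v) (In F v)"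
    and Out_linear: "v \<in> verts G \<Longrightarrow> linear_order_on (out_arcs G v) (Out F v)"

text \<open>Paths are lists of arcs, as in the theory of arc walks.\<close>

definition routes :: "('v, 'e) pre_digraph \<Rightarrow> 'v \<Rightarrow> 'v \<Rightarrow> 'e list set" where
  "routes G s t = {P. pre_digraph.apath G s P t}"

definition path_upto :: "('v, 'e) pre_digraph \<Rightarrow> 'e list \<Rightarrow> 'v \<Rightarrow> 'e list" where
  "path_upto G P v = takeWhile (\<lambda>e. tail G e \<noteq> v) P"

definition path_from :: "('v, 'e) pre_digraph \<Rightarrow> 'e list \<Rightarrow> 'v \<Rightarrow> 'e list" where
  "path_from G P v = dropWhile (\<lambda>e. tail G e \<noteq> v) P"

text \<open>For two paths with the same last vertex, \<open>R\<close> below is their longest common final part; it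
  starts at the vertex \<open>w = head G e = head G f\<close>. There are no such \<open>e\<close> and \<open>f\<close> if \<open>w\<close> is the
  first vertex of one of the two paths. The order on paths with the same first vertex is dual.\<close>

definition in_less :: "('v, 'e) pre_digraph \<Rightarrow> ('v, 'e) framing \<Rightarrow> 'e list \<Rightarrow> 'e list \<Rightarrow> bool" where
  "in_less G F P Q \<longleftrightarrow> (\<exists>P' Q' e f R. P = P' @ e # R \<and> Q = Q' @ f # R \<and>
     e \<noteq> f \<and> (e, f) \<in> In F (head G e))"

definition out_less :: "('v, 'e) pre_digraph \<Rightarrow> ('v, 'e) framing \<Rightarrow> 'e list \<Rightarrow> 'e list \<Rightarrow> bool" where
  "out_less G F P Q \<longleftrightarrow> (\<exists>P' Q' e f R. P = R @ e # P' \<and> Q = R @ f # Q' \<and>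
     e \<noteq> f \<and> (e, f) \<in> Out F (tail G e))"

definition cw :: "('v, 'e) pre_digraph \<Rightarrow> ('v, 'e) framing \<Rightarrow> 'v \<Rightarrow> 'e list \<Rightarrow> 'e list \<Rightarrow> bool" where
  "cw G F v P Q \<longleftrightarrow>
     v \<in> set (pre_digraph.inner_verts G P) \<inter> set (pre_digraph.inner_verts G Q) \<and>
     in_less G F (path_upto G P v) (path_upto G Q v) \<and>
     out_less G F (path_from G Q v) (path_from G P v)"

definition incoherent_at ::
  "('v, 'e) pre_digraph \<Rightarrow> ('v, 'e) framing \<Rightarrow> 'v \<Rightarrow> 'e list \<Rightarrow> 'e list \<Rightarrow> bool" where
  "incoherent_at G F v P Q \<longleftrightarrow> cw G F v P Q \<or> cw G F v Q P"

definition coherent ::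
  "('v, 'e) pre_digraph \<Rightarrow> ('v, 'e) framing \<Rightarrow> 'e list \<Rightarrow> 'e list \<Rightarrow> bool" where
  "coherent G F P Q \<longleftrightarrow> (\<forall>v. \<not> incoherent_at G F v P Q)"

definition clique ::
  "('v, 'e) pre_digraph \<Rightarrow> 'v \<Rightarrow> 'v \<Rightarrow> ('v, 'e) framing \<Rightarrow> 'e list set \<Rightarrow> bool" where
  "clique G s t F C \<longleftrightarrow> C \<subseteq> routes G s t \<and> pairwise (coherent G F) C"

definition maximal_cliques ::
  "('v, 'e) pre_digraph \<Rightarrow> 'v \<Rightarrow> 'v \<Rightarrow> ('v, 'e) framing \<Rightarrow> 'e list set set" where
  "maximal_cliques G s t F = {C. clique G s t F C \<and> (\<forall>D. clique G s t F D \<and> C \<subseteq> D \<longrightarrow> D = C)}"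

definition clique_step ::
  "('v, 'e) pre_digraph \<Rightarrow> 'v \<Rightarrow> 'v \<Rightarrow> ('v, 'e) framing \<Rightarrow> ('e list set) rel" where
  "clique_step G s t F = {(C, C'). C \<in> maximal_cliques G s t F \<and> C' \<in> maximal_cliques G s t F \<and>
     (\<exists>R \<in> C. \<exists>R'. C' = (C - {R}) \<union> {R'} \<and> (\<exists>u. cw G F u R R'))}"

definition framing_le ::
  "('v, 'e) pre_digraph \<Rightarrow> 'v \<Rightarrow> 'v \<Rightarrow> ('v, 'e) framing \<Rightarrow> ('e list set) rel" where
  "framing_le G s t F = (clique_step G s t F)\<^sup>*"


section \<open>The Cambrian caracol graph\<close>

datatype sign = Plus | Minus

text \<open>The source is \<open>Minf\<close>, the sink is \<open>Pinf\<close>, and \<open>Fin a\<close> is the vertex \<open>a\<close>. The graph has no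
  parallel edges, so an edge is the pair of its ends. As a graph it does not depend on the signs,
  which enter only through the framing.\<close>

type_synonym cvertex = "nat extended"
type_synonym cedge = "cvertex \<times> cvertex"

definition caracol :: "nat \<Rightarrow> (cvertex, cedge) pre_digraph" where
  "caracol n = \<lparr>verts = {Minf, Pinf} \<union> Fin ` {0..n},
     arcs = {(Minf, Fin 0), (Fin n, Pinf)} \<union> {(Fin (a - 1), Fin a) | a. a \<in> {1..n}}
       \<union> {(Minf, Fin a) | a. a \<in> {1..n}} \<union> {(Fin (a - 1), Pinf) | a. a \<in> {1..n}},
     tail = fst, head = snd\<rparr>"

text \<open>The edges entering and leaving a vertex, listed from top to bottom.\<close>

fun caracol_in :: "nat \<Rightarrow> (nat \<Rightarrow> sign) \<Rightarrow> cvertex \<Rightarrow> cedge list" where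
  "caracol_in n \<epsilon> Minf = []"
| "caracol_in n \<epsilon> (Fin a) =
     (if a = 0 then [(Minf, Fin 0)]
      else if \<epsilon> a = Plus then [(Minf, Fin a), (Fin (a - 1), Fin a)]
      else [(Fin (a - 1), Fin a), (Minf, Fin a)])"
| "caracol_in n \<epsilon> Pinf =
     map (\<lambda>a. (Fin (a - 1), Pinf)) [a \<leftarrow> [1..<n+1]. \<epsilon> a = Plus] @
     [(Fin n, Pinf)] @
     map (\<lambda>a. (Fin (a - 1), Pinf)) (rev [a \<leftarrow> [1..<n+1]. \<epsilon> a = Minus])"

fun caracol_out :: "nat \<Rightarrow> (nat \<Rightarrow> sign) \<Rightarrow> cvertex \<Rightarrow> cedge list" where
  "caracol_out n \<epsilon> Minf =
     map (\<lambda>a. (Minf, Fin a)) (rev [a \<leftarrow> [1..<n+1]. \<epsilon> a = Plus]) @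
     [(Minf, Fin 0)] @
     map (\<lambda>a. (Minf, Fin a)) [a \<leftarrow> [1..<n+1]. \<epsilon> a = Minus]"
| "caracol_out n \<epsilon> (Fin b) =
     (if b = n then [(Fin n, Pinf)]
      else if \<epsilon> (b + 1) = Plus then [(Fin b, Pinf), (Fin b, Fin (b + 1))]
      else [(Fin b, Fin (b + 1)), (Fin b, Pinf)])"
| "caracol_out n \<epsilon> Pinf = []"

definition list_order :: "'a list \<Rightarrow> 'a rel" where
  "list_order xs = {(xs ! i, xs ! j) | i j. i \<le> j \<and> j < length xs}"

definition caracol_framing :: "nat \<Rightarrow> (nat \<Rightarrow> sign) \<Rightarrow> (cvertex, cedge) framing" where
  "caracol_framing n \<epsilon> = \<lparr>In = \<lambda>v. list_order (caracol_in n \<epsilon> v),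
     Out = \<lambda>v. list_order (caracol_out n \<epsilon> v)\<rparr>"

lemma linear_order_on_list_order:
  assumes "distinct xs"
  shows "linear_order_on (set xs) (list_order xs)"
proof -
  have "antisym (list_order xs)"
    using assms by (fastforce simp: antisym_def list_order_def nth_eq_iff_index_eq)
  moreover have "trans (list_order xs)"
  proof (rule transI)
    fix x y z assume "(x, y) \<in> list_order xs" "(y, z) \<in> list_order xs"
    then obtain i j k l where *: "x = xs ! i" "y = xs ! j" "i \<le> j" "j < length xs"
      "y = xs ! k" "z = xs ! l" "k \<le> l" "l < length xs"
      by (auto simp: list_order_def)
    with assms have "j = k" by (simp add: nth_eq_iff_index_eq)
    with * have "x = xs ! i \<and> z = xs ! l \<and> i \<le> l \<and> l < length xs" by simp
    then show "(x, z) \<in> list_order xs" unfolding list_order_def by blast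
  qed
  moreover have "refl_on (set xs) (list_order xs)"
    by (fastforce simp: refl_on_def list_order_def in_set_conv_nth)
  moreover have "total_on (set xs) (list_order xs)"
    unfolding total_on_def list_order_def
    by (auto simp: in_set_conv_nth) (metis linorder_le_cases)
  moreover have "list_order xs \<subseteq> set xs \<times> set xs"
    by (auto simp: list_order_def)
  ultimately show ?thesis
    by (simp add: linear_order_on_def partial_order_on_def preorder_on_def)
qed

lemma framed_flow_graph_caracol:
  "framed_flow_graph (caracol n) Minf Pinf (caracol_framing n \<epsilon>)"
proof -
  have neq_Minus: "c = Plus" if "c \<noteq> Minus" for c
    using that by (cases c) simp_all
  have signs: "{1..n} = set [a \<leftarrow> [1..<n+1]. \<epsilon> a = Plus] \<union> set [a \<leftarrow> [1..<n+1]. \<epsilon> a = Minus]"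
    by (auto dest: neq_Minus)
  have in_set: "set (caracol_in n \<epsilon> v) = in_arcs (caracol n) v" if "v \<in> verts (caracol n)" for v
  proof (cases v)
    case (Fin a)
    show ?thesis
    proof (cases a)
      case 0
      with Fin show ?thesis by (auto simp: caracol_def in_arcs_def)
    next
      case (Suc b)
      with Fin that have "in_arcs (caracol n) v = {(Minf, Fin (Suc b)), (Fin b, Fin (Suc b))}"
        by (force simp: caracol_def in_arcs_def)
      with Fin Suc show ?thesis by auto
    qed
  next
    case Pinf
    have "in_arcs (caracol n) v = insert (Fin n, Pinf) ((\<lambda>a. (Fin (a - 1), Pinf)) ` {1..n})"
      using Pinf by (auto simp: caracol_def in_arcs_def)
    then show ?thesis unfolding signs Pinf by auto
  next
    case Minf
    then show ?thesis by (auto simp: caracol_def in_arcs_def)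
  qed
  have out_set: "set (caracol_out n \<epsilon> v) = out_arcs (caracol n) v" if "v \<in> verts (caracol n)" for v
  proof (cases v)
    case (Fin b)
    show ?thesis
    proof (cases "b = n")
      case True
      with Fin show ?thesis by (auto simp: caracol_def out_arcs_def)
    next
      case False
      with Fin that have b: "Suc b \<in> {1..n}" by (auto simp: caracol_def)
      have "(Fin b, Fin (Suc b)) \<in> arcs (caracol n)" "(Fin b, Pinf) \<in> arcs (caracol n)"
        using b by (force simp: caracol_def)+
      with Fin False have "out_arcs (caracol n) v = {(Fin b, Pinf), (Fin b, Fin (Suc b))}"
        by (auto simp: caracol_def out_arcs_def)
      with Fin False show ?thesis by auto
    qed
  next
    case Minf
    have "out_arcs (caracol n) v = insert (Minf, Fin 0) ((\<lambda>a. (Minf, Fin a)) ` {1..n})"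
      using Minf by (auto simp: caracol_def out_arcs_def)
    then show ?thesis unfolding signs Minf by auto
  next
    case Pinf
    then show ?thesis by (auto simp: caracol_def out_arcs_def)
  qed
  have in_distinct: "distinct (caracol_in n \<epsilon> v)" for v
  proof (cases v)
    case Pinf
    then show ?thesis by (auto simp: distinct_map inj_on_def eq_diff_iff)
  qed auto
  have out_distinct: "distinct (caracol_out n \<epsilon> v)" for v
    by (cases v) (auto simp: distinct_map inj_on_def)
  show ?thesis
  proof (unfold_locales)
    show "finite (arcs (caracol n))" by (simp add: caracol_def)
    fix v
    show "v \<in> verts (caracol n) \<and> in_arcs (caracol n) v = {} \<longleftrightarrow> v = Minf"
      proof -
      have "caracol_in n \<epsilon> v = [] \<longleftrightarrow> v = Minf" by (cases v) auto
      moreover have "Minf \<in> verts (caracol n)" by (simp add: caracol_def)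
      ultimately show ?thesis using in_set[of v] by (metis set_empty)
    qed
    show "v \<in> verts (caracol n) \<and> out_arcs (caracol n) v = {} \<longleftrightarrow> v = Pinf"
      proof -
      have "caracol_out n \<epsilon> v = [] \<longleftrightarrow> v = Pinf" by (cases v) auto
      moreover have "Pinf \<in> verts (caracol n)" by (simp add: caracol_def)
      ultimately show ?thesis using out_set[of v] by (metis set_empty)
    qed
    assume v: "v \<in> verts (caracol n)"
    show "linear_order_on (in_arcs (caracol n) v) (In (caracol_framing n \<epsilon>) v)"
      using linear_order_on_list_order[OF in_distinct[of v]] in_set[OF v]
      by (simp add: caracol_framing_def)
    show "linear_order_on (out_arcs (caracol n) v) (Out (caracol_framing n \<epsilon>) v)"
      using linear_order_on_list_order[OF out_distinct[of v]] out_set[OF v]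
      by (simp add: caracol_framing_def)
  qed (auto simp: caracol_def)
qed


section \<open>Triangulations of the polygon and the Cambrian lattice\<close>

abbreviation polygon :: "nat \<Rightarrow> (nat \<Rightarrow> real \<times> real) \<Rightarrow> (real \<times> real) set" where
  "polygon n p \<equiv> convex hull (p ` {0..n+1})"

definition cambrian_polygon :: "nat \<Rightarrow> (nat \<Rightarrow> sign) \<Rightarrow> (nat \<Rightarrow> real \<times> real) \<Rightarrow> bool" where
  "cambrian_polygon n \<epsilon> p \<longleftrightarrow>
     {x. x extreme_point_of polygon n p} = p ` {0..n+1} \<and>
     (\<forall>i j. i < j \<and> j \<le> n + 1 \<longrightarrow> fst (p i) < fst (p j)) \<and>
     snd (p 0) = snd (p (n + 1)) \<and>
     (\<forall>i \<in> {1..n}. case \<epsilon> i of Plus \<Rightarrow> snd (p i) > snd (p 0) | Minus \<Rightarrow> snd (p i) < snd (p 0))"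

lemma cambrian_polygon_exists: "\<exists>p. cambrian_polygon n \<epsilon> p"
proof -
  define x where "x i = 2 * real i / (real n + 1) - 1" for i
  define y where "y i = (if \<epsilon> i = Plus \<or> i = 0 \<or> i = n + 1 then 1 else - 1) * sqrt (1 - (x i)\<^sup>2)" for i
  define p where "p i = (x i, y i)" for i
  have xle: "\<bar>x i\<bar> \<le> 1" if "i \<le> n + 1" for i
    using that by (auto simp: x_def abs_le_iff field_simps)
  have xlt: "\<bar>x i\<bar> < 1" if "i \<in> {1..n}" for i
    using that by (auto simp: x_def abs_less_iff field_simps)
  have norm_p: "norm (p i) = 1" if "i \<le> n + 1" for i
    using xle[OF that] abs_square_le_1[of "x i"]
    by (simp add: p_def y_def norm_Pair power_mult_distrib)
  have "polygon n p \<subseteq> cball 0 1"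
    by (rule hull_minimal) (auto simp: norm_p)
  then have ball: "norm z \<le> 1" if "z \<in> polygon n p" for z
    using that by auto
  have "p i extreme_point_of polygon n p" if i: "i \<le> n + 1" for i
    unfolding extreme_point_of_def
  proof (intro conjI ballI notI)
    show "p i \<in> polygon n p" using i by (intro hull_inc) auto
    fix a b assume ab: "a \<in> polygon n p" "b \<in> polygon n p" "p i \<in> open_segment a b"
    then obtain u where u: "0 < u" "u < 1" "p i = (1 - u) *\<^sub>R a + u *\<^sub>R b"
      by (auto simp: in_segment)
    have "1 \<le> (1 - u) * norm a + u * norm b"
      using norm_triangle_ineq[of "(1 - u) *\<^sub>R a" "u *\<^sub>R b"] u norm_p[OF i] by simp
    moreover have "(1 - u) * norm a \<le> 1 - u" "u * norm b \<le> u"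
      using u ball[OF ab(1)] ball[OF ab(2)] by (simp_all add: mult_left_le)
    ultimately have "(1 - u) * norm a = 1 - u" "u * norm b = u" by linarith+
    then have "norm a = 1" "norm b = 1" using u by simp_all
    with different_norm_3_collinear_points[OF ab(3)] norm_p[OF i] show False by simp
  qed
  then have "{x. x extreme_point_of polygon n p} = p ` {0..n+1}"
    using extreme_points_of_convex_hull[of "p ` {0..n+1}"] by auto
  moreover have "fst (p i) < fst (p j)" if "i < j" for i j
    using that by (simp add: p_def x_def divide_strict_right_mono)
  moreover have "y 0 = 0" "y (n + 1) = 0"
    by (simp_all add: y_def x_def field_simps)
  moreover have "case \<epsilon> i of Plus \<Rightarrow> y i > 0 | Minus \<Rightarrow> y i < 0" if "i \<in> {1..n}" for i
    using xlt[OF that] that abs_square_less_1[of "x i"] by (auto simp: y_def split: sign.split)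
  ultimately have "cambrian_polygon n \<epsilon> p"
    unfolding cambrian_polygon_def p_def by (simp cong: sign.case_cong)
  then show ?thesis by blast
qed

definition sides :: "nat \<Rightarrow> (nat \<Rightarrow> real \<times> real) \<Rightarrow> nat set set" where
  "sides n p = {{i, j} | i j. i \<le> n + 1 \<and> j \<le> n + 1 \<and> i \<noteq> j \<and>
     closed_segment (p i) (p j) face_of polygon n p}"

definition diagonals :: "nat \<Rightarrow> (nat \<Rightarrow> real \<times> real) \<Rightarrow> nat set set" where
  "diagonals n p = {{i, j} | i j. i \<le> n + 1 \<and> j \<le> n + 1 \<and> i \<noteq> j} - sides n p"

definition crossing :: "(nat \<Rightarrow> real \<times> real) \<Rightarrow> nat set \<Rightarrow> nat set \<Rightarrow> bool" where
  "crossing p d e \<longleftrightarrow> (\<exists>i j k l. d = {i, j} \<and> e = {k, l} \<and>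
     open_segment (p i) (p j) \<inter> open_segment (p k) (p l) \<noteq> {})"

definition noncrossing :: "nat \<Rightarrow> (nat \<Rightarrow> real \<times> real) \<Rightarrow> nat set set \<Rightarrow> bool" where
  "noncrossing n p T \<longleftrightarrow> T \<subseteq> diagonals n p \<and> pairwise (\<lambda>d e. \<not> crossing p d e) T"

text \<open>A triangulation is given by its set of diagonals, a maximal set of pairwise noncrossing
  diagonals.\<close>

definition triangulations :: "nat \<Rightarrow> (nat \<Rightarrow> real \<times> real) \<Rightarrow> nat set set set" where
  "triangulations n p = {T. noncrossing n p T \<and> (\<forall>U. noncrossing n p U \<and> T \<subseteq> U \<longrightarrow> U = T)}"

text \<open>Since all vertices lie on the boundary of the convex polygon, three vertices span a triangle
  of \<open>T\<close> as soon as they are pairwise joined by a side or a diagonal in \<open>T\<close>.\<close>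

definition triangle :: "nat \<Rightarrow> (nat \<Rightarrow> real \<times> real) \<Rightarrow> nat set set \<Rightarrow> nat \<Rightarrow> nat \<Rightarrow> nat \<Rightarrow> bool" where
  "triangle n p T a b c \<longleftrightarrow> distinct [a, b, c] \<and> {{a, b}, {b, c}, {a, c}} \<subseteq> T \<union> sides n p"

definition slope :: "(nat \<Rightarrow> real \<times> real) \<Rightarrow> nat \<Rightarrow> nat \<Rightarrow> real" where
  "slope p a b = (snd (p b) - snd (p a)) / (fst (p b) - fst (p a))"

definition increasing_flip :: "nat \<Rightarrow> (nat \<Rightarrow> real \<times> real) \<Rightarrow> (nat set set) rel" where
  "increasing_flip n p = {(T, T'). T \<in> triangulations n p \<and> T' \<in> triangulations n p \<and>
     (\<exists>a b c d. {a, b} \<in> T \<and> triangle n p T a b c \<and> triangle n p T a b d \<and> c \<noteq> d \<and>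
        T' = (T - {{a, b}}) \<union> {{c, d}} \<and> slope p a b < slope p c d)}"

definition cambrian_le :: "nat \<Rightarrow> (nat \<Rightarrow> real \<times> real) \<Rightarrow> (nat set set) rel" where
  "cambrian_le n p = (increasing_flip n p)\<^sup>*"


section \<open>Isomorphism of posets\<close>

definition order_isomorphic :: "'a set \<Rightarrow> 'a rel \<Rightarrow> 'b set \<Rightarrow> 'b rel \<Rightarrow> bool" where
  "order_isomorphic A r B r' \<longleftrightarrow> (\<exists>f. bij_betw f A B \<and>
     (\<forall>x \<in> A. \<forall>y \<in> A. (x, y) \<in> r \<longleftrightarrow> (f x, f y) \<in> r'))"

end

theory Submission
  imports Defs
begin

text \<open>A route through \<open>i, i + 1, \<dots>, j - 1\<close> corresponds to the chord \<open>{i, j}\<close> of the polygon.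
  For two such routes \<open>P\<close> and \<open>Q\<close>, the clockwise relation does not depend on the common inner
  vertex: it says that the chord of \<open>Q\<close> is below that of \<open>P\<close> at the left end of their common
  \<open>x\<close>-range and above it at the right end, because a vertex between the ends of a chord lies above
  the chord iff its sign is \<open>Plus\<close>. So incoherent routes are crossing chords, with the chord of \<open>Q\<close>
  steeper than that of \<open>P\<close>, and maximal cliques are triangulations together with all sides. If two
  triangulations differ in one diagonal, then both contain, up to sides, the quadrilateral spanned
  by the two exchanged diagonals, so the steps of both orders agree.\<close>

section \<open>Routes of the caracol graph\<close>

lemma first_difference_unique:
  assumes "R @ e # A = R' @ e' # A'" "R @ f # B = R' @ f' # B'" "e \<noteq> f" "e' \<noteq> f'"
  shows "R = R' \<and> e = e' \<and> f = f'"
  using assms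
proof (induction R arbitrary: R')
  case Nil then show ?case by (cases R') auto
next
  case (Cons a R) then show ?case by (cases R') auto
qed

lemma last_difference_unique:
  assumes "A @ e # R = A' @ e' # R'" "B @ f # R = B' @ f' # R'" "e \<noteq> f" "e' \<noteq> f'"
  shows "R = R' \<and> e = e' \<and> f = f'"
  using first_difference_unique[of "rev R" e "rev A" "rev R'" e' "rev A'" f "rev B" f' "rev B'"]
    arg_cong[OF assms(1), of rev] arg_cong[OF assms(2), of rev] assms(3,4)
  by simp

text \<open>The existential in \<open>in_less\<close> determines its \<open>e\<close>,
  \<open>f\<close> and \<open>R\<close>, because \<open>e \<noteq> f\<close> makes \<open>R\<close>
  the longest common final part. Any one splitting therefore evaluates the order; dually for
  \<open>out_less\<close>.\<close>

lemma in_less_iff: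
  assumes "e \<noteq> f"
  shows "in_less G F (A @ e # R) (B @ f # R) \<longleftrightarrow> (e, f) \<in> In F (head G e)"
proof
  assume "in_less G F (A @ e # R) (B @ f # R)"
  then obtain P' Q' e' f' R' where *: "A @ e # R = P' @ e' # R'" "B @ f # R = Q' @ f' # R'"
    "e' \<noteq> f'" "(e', f') \<in> In F (head G e')"
    unfolding in_less_def by blast
  from last_difference_unique[OF *(1,2) assms *(3)] *(4)
  show "(e, f) \<in> In F (head G e)" by simp
qed (use assms in \<open>unfold in_less_def, blast\<close>)

lemma out_less_iff:
  assumes "e \<noteq> f"
  shows "out_less G F (R @ e # A) (R @ f # B) \<longleftrightarrow> (e, f) \<in> Out F (tail G e)"
proof
  assume "out_less G F (R @ e # A) (R @ f # B)"
  then obtain P' Q' e' f' R' where *: "R @ e # A = R' @ e' # P'" "R @ f # B = R' @ f' # Q'"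
    "e' \<noteq> f'" "(e', f') \<in> Out F (tail G e')"
    unfolding out_less_def by blast
  from first_difference_unique[OF *(1,2) assms *(3)] *(4)
  show "(e, f) \<in> Out F (tail G e)" by simp
qed (use assms in \<open>unfold out_less_def, blast\<close>)

lemma not_in_less_self: "\<not> in_less G F P P"
proof
  assume "in_less G F P P"
  then obtain P' Q' e f R where *: "P = P' @ e # R" "P = Q' @ f # R" "e \<noteq> f"
    unfolding in_less_def by blast
  have eq: "P' @ e # R = Q' @ f # R"
    by (rule trans[OF *(1)[symmetric] *(2)])
  \<comment> \<open>Comparing lengths gives \<open>length P' = length Q'\<close>, so the two sides
    agree entry by entry and \<open>e = f\<close>.\<close>
  with arg_cong[OF eq, of length] \<open>e \<noteq> f\<close> show False by simp
qed

lemma not_out_less_self: "\<not> out_less G F P P"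
proof
  assume "out_less G F P P"
  then obtain P' Q' e f R where *: "P = R @ e # P'" "P = R @ f # Q'" "e \<noteq> f"
    unfolding out_less_def by blast
  have "R @ e # P' = R @ f # Q'"
    by (rule trans[OF *(1)[symmetric] *(2)])
  with \<open>e \<noteq> f\<close> show False by simp
qed

lemma list_order_pair:
  assumes "x \<noteq> y"
  shows "(a, b) \<in> list_order [x, y] \<longleftrightarrow> a = x \<and> b = x \<or> a = x \<and> b = y \<or> a = y \<and> b = y"
proof -
  have len: "length [x, y] = 2" by simp
  have "(a, b) \<in> list_order [x, y] \<longleftrightarrow> (\<exists>j<2. \<exists>i\<le>j. a = [x, y] ! i \<and> b = [x, y] ! j)"
    unfolding list_order_def len by blast
  also have "\<dots> \<longleftrightarrow> (\<exists>i\<le>0. a = [x, y] ! i \<and> b = x) \<or> (\<exists>i\<le>1. a = [x, y] ! i \<and> b = y)"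
    by (simp add: numeral_2_eq_2 less_Suc_eq ex_disj_distrib conj_disj_distribR)
  also have "\<dots> \<longleftrightarrow> a = x \<and> b = x \<or> a = x \<and> b = y \<or> a = y \<and> b = y"
    by (auto simp: le_Suc_eq)
  finally show ?thesis .
qed

section \<open>Routes encoded as chords\<close>

definition hedge :: "nat \<Rightarrow> cedge" where
  "hedge k = (Fin k, Fin (Suc k))"

text \<open>The last inner vertex is \<open>j - 1\<close> because the arcs \<open>(s, a)\<close> and
  \<open>(a - 1, t)\<close> both take their side from the sign of \<open>a\<close>: with this shift
  each end of a chord names the sign that places its arc. The start \<open>0\<close> and the end
  \<open>n + 1\<close> belong to horizontal arcs.\<close>

definition route :: "nat \<times> nat \<Rightarrow> cedge list" where
  "route = (\<lambda>(i, j). (Minf, Fin i) # map hedge [i..<j - 1] @ [(Fin (j - 1), Pinf)])"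

definition chords :: "nat \<Rightarrow> (nat \<times> nat) set" where
  "chords n = {(i, j). i < j \<and> j \<le> n + 1}"

definition ends :: "nat \<times> nat \<Rightarrow> nat set" where
  "ends x = {fst x, snd x}"

text \<open>The conjuncts say that the routes share an inner vertex, that the first arrives above
  the second, and that the second leaves above the first. At the larger start one route enters from
  the source, at the smaller end one leaves to the sink, and the sign there tells on which side. For
  chords every sign consulted belongs to an index in \<open>{1..n}\<close>.\<close>

definition chord_cw :: "(nat \<Rightarrow> sign) \<Rightarrow> nat \<times> nat \<Rightarrow> nat \<times> nat \<Rightarrow> bool" where
  "chord_cw \<epsilon> = (\<lambda>(i, j) (k, l). max i k < min j l \<and>
     (i < k \<and> \<epsilon> k = Minus \<or> k < i \<and> \<epsilon> i = Plus) \<and>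
     (l < j \<and> \<epsilon> l = Plus \<or> j < l \<and> \<epsilon> j = Minus))"

lemma sign_neq: "c \<noteq> Plus \<longleftrightarrow> c = Minus" "c \<noteq> Minus \<longleftrightarrow> c = Plus"
  by (cases c, simp, simp)+

lemma caracol_tail_head [simp]: "tail (caracol n) = fst" "head (caracol n) = snd"
  by (simp_all add: caracol_def)

lemma arcs_caracol_Minf [simp]: "(Minf, v) \<in> arcs (caracol n) \<longleftrightarrow> (\<exists>a\<le>n. v = Fin a)"
  by (auto simp: caracol_def)

lemma arcs_caracol_Pinf [simp]: "(Pinf, v) \<notin> arcs (caracol n)"
  by (auto simp: caracol_def)

lemma arcs_caracol_Fin [simp]:
  "(Fin a, v) \<in> arcs (caracol n) \<longleftrightarrow> a < n \<and> v = Fin (Suc a) \<or> a \<le> n \<and> v = Pinf"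
proof -
  have "(Fin a, Fin (Suc a)) \<in> arcs (caracol n)" if "a < n"
    using that by (auto simp: caracol_def intro!: exI[of _ "Suc a"])
  \<comment> \<open>For \<open>a < n\<close> the arc to the sink has index \<open>Suc a\<close>;
    from \<open>n\<close> it is the last horizontal arc.\<close>
  moreover have "(Fin a, Pinf) \<in> arcs (caracol n)" if "a \<le> n"
    using that by (cases "a = n") (auto simp: caracol_def intro!: exI[of _ "Suc a"])
  ultimately show ?thesis by (auto simp: caracol_def)
qed

lemma caracol_awalk_Cons:
  "pre_digraph.awalk (caracol n) u (e # P) w \<longleftrightarrow>
    e \<in> arcs (caracol n) \<and> u = fst e \<and> pre_digraph.awalk (caracol n) (snd e) P w"
proof -
  \<comment> \<open>Walks depend on the digraph alone, so an arbitrary sign function serves to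
    obtain its general facts.\<close>
  interpret framed_flow_graph "caracol n" Minf Pinf "caracol_framing n (\<lambda>_. Plus)"
    by (rule framed_flow_graph_caracol)
  show ?thesis by (simp add: awalk_Cons_iff)
qed

lemma caracol_awalk_Nil: "pre_digraph.awalk (caracol n) u [] w \<longleftrightarrow> u \<in> verts (caracol n) \<and> u = w"
  by (simp add: pre_digraph.awalk_def pre_digraph.cas.simps)

lemma caracol_awalk_from_Pinf: "pre_digraph.awalk (caracol n) Pinf P w \<Longrightarrow> P = []"
  by (cases P) (auto simp: caracol_awalk_Cons)

text \<open>An arc from an inner vertex leads to the next vertex or to the sink, where every walk
  stops, so the walk runs horizontally until it exits at some \<open>b\<close>.\<close>

lemma caracol_awalk_from_Fin:
  assumes "pre_digraph.awalk (caracol n) (Fin a) P Pinf"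
  shows "\<exists>b. a \<le> b \<and> b \<le> n \<and> P = map hedge [a..<b] @ [(Fin b, Pinf)]"
  using assms
proof (induction P arbitrary: a)
  case Nil
  then show ?case by (simp add: caracol_awalk_Nil)
next
  case (Cons e P)
  then obtain v where e: "e = (Fin a, v)" "e \<in> arcs (caracol n)"
    and P: "pre_digraph.awalk (caracol n) v P Pinf"
    by (cases e) (auto simp: caracol_awalk_Cons)
  then consider "a \<le> n" "v = Pinf" | "v = Fin (Suc a)" by auto
  then show ?case
  proof cases
    case 1
    with P e caracol_awalk_from_Pinf show ?thesis by (intro exI[of _ a]) auto
  next
    case 2
    with P obtain b where "Suc a \<le> b" "b \<le> n" "P = map hedge [Suc a..<b] @ [(Fin b, Pinf)]"
      using Cons.IH[of "Suc a"] by auto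
    with e 2 show ?thesis by (intro exI[of _ b]) (auto simp: upt_conv_Cons hedge_def)
  qed
qed

lemma caracol_awalk_to_Pinf:
  assumes "a \<le> b" "b \<le> n"
  shows "pre_digraph.awalk (caracol n) (Fin a) (map hedge [a..<b] @ [(Fin b, Pinf)]) Pinf"
  using assms
proof (induction a rule: inc_induct)
  case base
  have "Pinf \<in> verts (caracol n)" by (simp add: caracol_def)
  with base show ?case by (simp add: caracol_awalk_Cons caracol_awalk_Nil)
next
  case (step a)
  then show ?case by (simp add: caracol_awalk_Cons upt_conv_Cons hedge_def)
qed

lemma routes_caracol: "routes (caracol n) Minf Pinf = route ` chords n"
proof (intro equalityI subsetI)
  fix P assume "P \<in> routes (caracol n) Minf Pinf"
  then have P: "pre_digraph.awalk (caracol n) Minf P Pinf"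
    by (simp add: routes_def pre_digraph.apath_def)
  then obtain e Q where Q: "P = e # Q" by (cases P) (auto simp: caracol_awalk_Nil)
  with P obtain a where "e = (Minf, Fin a)" "pre_digraph.awalk (caracol n) (Fin a) Q Pinf"
    by (cases e) (auto simp: caracol_awalk_Cons)
  moreover from caracol_awalk_from_Fin[OF this(2)] obtain b
    where "a \<le> b" "b \<le> n" "Q = map hedge [a..<b] @ [(Fin b, Pinf)]" by blast
  ultimately show "P \<in> route ` chords n"
    using Q by (intro image_eqI[of _ _ "(a, Suc b)"]) (auto simp: route_def chords_def)
next
  fix P assume "P \<in> route ` chords n"
  then obtain a j where "a < j" "j \<le> n + 1" "P = route (a, j)"
    by (auto simp: chords_def)
  then obtain b where ab: "a \<le> b" "b \<le> n" and P: "P = (Minf, Fin a) # map hedge [a..<b] @ [(Fin b, Pinf)]"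
    by (cases j) (auto simp: route_def)
  then have w: "pre_digraph.awalk (caracol n) Minf P Pinf"
    using caracol_awalk_to_Pinf[OF ab] by (simp add: caracol_awalk_Cons)
  interpret framed_flow_graph "caracol n" Minf Pinf "caracol_framing n (\<lambda>_. Plus)"
    by (rule framed_flow_graph_caracol)
  \<comment> \<open>The vertices of the walk are the tails of its arcs followed by the sink; they
    are distinct, so the walk is a path.\<close>
  have "map fst P = Minf # map Fin [a..<Suc b]"
    using ab by (auto simp: P hedge_def)
  then have "awalk_verts Minf P = Minf # map Fin [a..<Suc b] @ [Pinf]"
    by (simp add: awalk_verts_conv P)
  then have "distinct (awalk_verts Minf P)" by (auto simp: distinct_map inj_on_def)
  with w show "P \<in> routes (caracol n) Minf Pinf" by (simp add: routes_def apath_def)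
qed

lemma inj_on_route: "inj_on route (chords n)"
proof (rule inj_onI, clarify)
  fix i j k l assume *: "(i, j) \<in> chords n" "(k, l) \<in> chords n" "route (i, j) = route (k, l)"
  \<comment> \<open>The last arc determines \<open>j - 1\<close>, hence \<open>j\<close>, which is
    positive for a chord; the first arc gives \<open>i\<close>.\<close>
  then have "last (route (i, j)) = last (route (k, l))" by simp
  with * show "i = k \<and> j = l" by (auto simp: route_def chords_def)
qed

section \<open>Subpaths of routes at an inner vertex and their orders\<close>

lemma route_inner_verts:
  assumes "(i, j) \<in> chords n"
  shows "set (pre_digraph.inner_verts (caracol n) (route (i, j))) = Fin ` {i..<j}"
proof -
  have "[i..<j] = [i..<j - 1] @ [j - 1]"
    using assms by (cases j) (auto simp: chords_def)
  then have "pre_digraph.inner_verts (caracol n) (route (i, j)) = map Fin [i..<j]"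
    by (simp add: pre_digraph.inner_verts_def route_def caracol_def hedge_def)
  then show ?thesis by simp
qed

lemma upt_append: "i \<le> j \<Longrightarrow> j \<le> k \<Longrightarrow> [i..<k] = [i..<j] @ [j..<k]"
  using upt_add_eq_append[of i j "k - j"] by simp

lemma route_split:
  assumes "i \<le> m" "m < j"
  shows "route (i, j) = ((Minf, Fin i) # map hedge [i..<m]) @ map hedge [m..<j - 1] @ [(Fin (j - 1), Pinf)]"
  using assms upt_append[of i m "j - 1"] by (simp add: route_def)

lemma path_upto_route:
  assumes "i \<le> m" "m < j"
  shows "path_upto (caracol n) (route (i, j)) (Fin m) = (Minf, Fin i) # map hedge [i..<m]"
proof (cases "m < j - 1")
  \<comment> \<open>Here the arc leaving \<open>m\<close> is horizontal; at the last inner vertex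
    \<open>j - 1\<close> it is the arc to the sink.\<close>
  case True
  show ?thesis unfolding path_upto_def route_split[OF assms]
    by (subst takeWhile_append2) (use True in \<open>auto simp: caracol_def hedge_def upt_conv_Cons\<close>)
next
  case False
  with assms have "m = j - 1" by simp
  then show ?thesis unfolding path_upto_def route_split[OF assms]
    by (subst takeWhile_append2) (auto simp: caracol_def hedge_def)
qed

lemma path_from_route:
  assumes "i \<le> m" "m < j"
  shows "path_from (caracol n) (route (i, j)) (Fin m) = map hedge [m..<j - 1] @ [(Fin (j - 1), Pinf)]"
proof (cases "m < j - 1")
  case True
  show ?thesis unfolding path_from_def route_split[OF assms]
    by (subst dropWhile_append2) (use True in \<open>auto simp: caracol_def hedge_def upt_conv_Cons\<close>)
next
  case False
  with assms have "m = j - 1" by simp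
  then show ?thesis unfolding path_from_def route_split[OF assms]
    by (subst dropWhile_append2) (auto simp: caracol_def hedge_def)
qed

text \<open>\<open>hedge (k - 1)\<close> is the arc that comparisons need: it enters
  \<open>k\<close>, where another route may start, and leaves \<open>k - 1\<close>, the last inner
  vertex of a chord ending at \<open>k\<close>.\<close>

lemma map_hedge_split:
  assumes "i < k" "k \<le> m"
  shows "map hedge [i..<m] = map hedge [i..<k - 1] @ hedge (k - 1) # map hedge [k..<m]"
proof -
  have "[i..<m] = [i..<k - 1] @ [k - 1..<m]"
    using assms upt_append[of i "k - 1" m] by simp
  moreover have "[k - 1..<m] = (k - 1) # [k..<m]"
    using assms by (subst upt_conv_Cons) auto
  ultimately show ?thesis by simp
qed

text \<open>If \<open>i < k\<close>, the paths coincide from \<open>k\<close> on; there the first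
  arrives by \<open>hedge (k - 1)\<close> and the second from the source, and the sign of
  \<open>k\<close> decides which is on top. The case \<open>k < i\<close> is symmetric.\<close>

lemma in_less_route:
  assumes "i \<le> m" "k \<le> m"
  shows "in_less (caracol n) (caracol_framing n \<epsilon>)
      ((Minf, Fin i) # map hedge [i..<m]) ((Minf, Fin k) # map hedge [k..<m]) \<longleftrightarrow>
    i < k \<and> \<epsilon> k = Minus \<or> k < i \<and> \<epsilon> i = Plus"
proof (cases i k rule: linorder_cases)
  case less
  have "in_less (caracol n) (caracol_framing n \<epsilon>)
      (((Minf, Fin i) # map hedge [i..<k - 1]) @ hedge (k - 1) # map hedge [k..<m])
      ([] @ (Minf, Fin k) # map hedge [k..<m]) \<longleftrightarrow> \<epsilon> k = Minus"
    using less by (subst in_less_iff)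
      (auto simp: hedge_def caracol_framing_def caracol_def list_order_pair sign_neq)
  with less show ?thesis by (simp add: map_hedge_split[OF less assms(2)])
next
  case greater
  have "in_less (caracol n) (caracol_framing n \<epsilon>)
      ([] @ (Minf, Fin i) # map hedge [i..<m])
      (((Minf, Fin k) # map hedge [k..<i - 1]) @ hedge (i - 1) # map hedge [i..<m]) \<longleftrightarrow> \<epsilon> i = Plus"
    using greater by (subst in_less_iff)
      (auto simp: hedge_def caracol_framing_def caracol_def list_order_pair sign_neq)
  with greater show ?thesis by (simp add: map_hedge_split[OF greater assms(1)])
qed (simp add: not_in_less_self)

text \<open>If \<open>j < l\<close>, the paths part at \<open>j - 1\<close>, where the first takes
  the arc to the sink and the second \<open>hedge (j - 1)\<close>; the outgoing order at
  \<open>j - 1\<close> uses the sign of \<open>j\<close>.\<close>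

lemma out_less_route:
  assumes "m < j" "m < l" "j \<le> n + 1" "l \<le> n + 1"
  shows "out_less (caracol n) (caracol_framing n \<epsilon>)
      (map hedge [m..<j - 1] @ [(Fin (j - 1), Pinf)]) (map hedge [m..<l - 1] @ [(Fin (l - 1), Pinf)]) \<longleftrightarrow>
    j < l \<and> \<epsilon> j = Plus \<or> l < j \<and> \<epsilon> l = Minus"
proof (cases j l rule: linorder_cases)
  case less
  have "out_less (caracol n) (caracol_framing n \<epsilon>)
      (map hedge [m..<j - 1] @ (Fin (j - 1), Pinf) # [])
      (map hedge [m..<j - 1] @ hedge (j - 1) # map hedge [j..<l - 1] @ [(Fin (l - 1), Pinf)])
      \<longleftrightarrow> \<epsilon> j = Plus"
    using less assms by (subst out_less_iff)
      (auto simp: hedge_def caracol_framing_def caracol_def list_order_pair sign_neq)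
  with less map_hedge_split[of m j "l - 1"] assms show ?thesis by simp
next
  case greater
  have "out_less (caracol n) (caracol_framing n \<epsilon>)
      (map hedge [m..<l - 1] @ hedge (l - 1) # map hedge [l..<j - 1] @ [(Fin (j - 1), Pinf)])
      (map hedge [m..<l - 1] @ (Fin (l - 1), Pinf) # [])
      \<longleftrightarrow> \<epsilon> l = Minus"
    using greater assms by (subst out_less_iff)
      (auto simp: hedge_def caracol_framing_def caracol_def list_order_pair sign_neq)
  with greater map_hedge_split[of m l "j - 1"] assms show ?thesis by simp
qed (simp add: not_out_less_self)

text \<open>The incoming order depends only on the starts and the outgoing order only on the ends,
  so all common inner vertices give the same answer; \<open>max i k < min j l\<close> says that one
  exists.\<close>

lemma cw_route_iff:
  assumes "x \<in> chords n" "y \<in> chords n"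
  shows "(\<exists>v. cw (caracol n) (caracol_framing n \<epsilon>) v (route x) (route y)) \<longleftrightarrow> chord_cw \<epsilon> x y"
proof -
  obtain i j k l where xy: "x = (i, j)" "y = (k, l)" by (cases x, cases y)
  note c = assms[unfolded xy]
  have *: "cw (caracol n) (caracol_framing n \<epsilon>) (Fin m) (route x) (route y) \<longleftrightarrow> chord_cw \<epsilon> x y"
    if "max i k \<le> m" "m < min j l" for m
proof -
    have m: "i \<le> m" "m < j" "k \<le> m" "m < l" and n: "j \<le> n + 1" "l \<le> n + 1"
      using that c by (auto simp: chords_def)
    have "Fin m \<in> set (pre_digraph.inner_verts (caracol n) (route x)) \<inter>
        set (pre_digraph.inner_verts (caracol n) (route y))"
      using m c by (simp add: xy route_inner_verts)
    then show ?thesis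
      using that unfolding cw_def xy path_upto_route[OF m(1,2)] path_upto_route[OF m(3,4)]
        path_from_route[OF m(1,2)] path_from_route[OF m(3,4)] in_less_route[OF m(1,3)]
        out_less_route[OF m(4,2) n(2,1)] chord_cw_def by auto
  qed
  show ?thesis
  proof
    assume "\<exists>v. cw (caracol n) (caracol_framing n \<epsilon>) v (route x) (route y)"
    then obtain v where v: "cw (caracol n) (caracol_framing n \<epsilon>) v (route x) (route y)" ..
    then obtain m where "v = Fin m" "max i k \<le> m" "m < min j l"
      using c by (auto simp: cw_def xy route_inner_verts)
    with * v show "chord_cw \<epsilon> x y" by blast
  next
    assume cw: "chord_cw \<epsilon> x y"
    then have "max i k < min j l" by (auto simp: chord_cw_def xy)
    with * cw show "\<exists>v. cw (caracol n) (caracol_framing n \<epsilon>) v (route x) (route y)" by blast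
  qed
qed

section \<open>Maximal noncrossing sets of chords\<close>

lemma order_isomorphicI:
  assumes "bij_betw g M A" "bij_betw h M B"
    and "\<And>x y. x \<in> M \<Longrightarrow> y \<in> M \<Longrightarrow> (g x, g y) \<in> r \<longleftrightarrow> (h x, h y) \<in> r'"
  shows "order_isomorphic A r B r'"
proof -
  \<comment> \<open>The isomorphism returns along \<open>g\<close> to the common index set and then
    follows \<open>h\<close>.\<close>
  have "bij_betw (h \<circ> inv_into M g) A B"
    using bij_betw_trans[OF bij_betw_inv_into[OF assms(1)] assms(2)] .
  moreover have "(a, b) \<in> r \<longleftrightarrow> ((h \<circ> inv_into M g) a, (h \<circ> inv_into M g) b) \<in> r'"
    if "a \<in> A" "b \<in> A" for a b
  proof -
    have "inv_into M g a \<in> M" "inv_into M g b \<in> M"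
      using that bij_betw_inv_into[OF assms(1)] by (auto dest: bij_betwE)
    with assms(3) that show ?thesis
      by (simp add: bij_betw_inv_into_right[OF assms(1)] flip: assms(3))
  qed
  ultimately show ?thesis unfolding order_isomorphic_def by blast
qed

lemma rtrancl_image_iff:
  assumes g: "bij_betw g M A" and r: "r \<subseteq> A \<times> A" and q: "q \<subseteq> M \<times> M"
    and step: "\<And>x y. x \<in> M \<Longrightarrow> y \<in> M \<Longrightarrow> (g x, g y) \<in> r \<longleftrightarrow> (x, y) \<in> q"
    and x: "x \<in> M" "y \<in> M"
  shows "(g x, g y) \<in> r\<^sup>* \<longleftrightarrow> (x, y) \<in> q\<^sup>*"
proof
  \<comment> \<open>The target is generalised from \<open>g y\<close> to any \<open>b\<close> so
    that a chain can be lifted step by step; each new element is an image because \<open>r\<close>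
    stays inside \<open>A\<close>.\<close>
  have "\<exists>z\<in>M. b = g z \<and> (x, z) \<in> q\<^sup>*" if "(g x, b) \<in> r\<^sup>*" for b
    using that
  proof (induction rule: rtrancl_induct)
    case base
    with x show ?case by blast
  next
    case (step b c)
    then obtain z where z: "z \<in> M" "b = g z" "(x, z) \<in> q\<^sup>*" by blast
    moreover obtain w where w: "w \<in> M" "c = g w"
      using r step(2) bij_betw_imp_surj_on[OF g] by blast
    ultimately have "(z, w) \<in> q" using step(2) assms(4) by blast
    with z w show ?case using rtrancl.rtrancl_into_rtrancl[of x z q w] by blast
  qed
  moreover assume "(g x, g y) \<in> r\<^sup>*"
  ultimately obtain z where "z \<in> M" "g y = g z" "(x, z) \<in> q\<^sup>*" by blast
  moreover from this have "y = z" using bij_betw_imp_inj_on[OF g] x by (simp add: inj_onD)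
  ultimately show "(x, y) \<in> q\<^sup>*" by simp
next
  assume "(x, y) \<in> q\<^sup>*"
  then show "(g x, g y) \<in> r\<^sup>*"
  proof (induction rule: rtrancl_induct)
    case (step y z)
    then have "(g y, g z) \<in> r" using q assms(4) by blast
    with step show ?case by (meson rtrancl.rtrancl_into_rtrancl)
  qed simp
qed

section \<open>Cliques of chords and the cyclic order of their ends\<close>

definition chord_cliques :: "nat \<Rightarrow> (nat \<Rightarrow> sign) \<Rightarrow> (nat \<times> nat) set set" where
  "chord_cliques n \<epsilon> = {X. X \<subseteq> chords n \<and> (\<forall>x\<in>X. \<forall>y\<in>X. \<not> chord_cw \<epsilon> x y)}"

definition max_chord_cliques :: "nat \<Rightarrow> (nat \<Rightarrow> sign) \<Rightarrow> (nat \<times> nat) set set" where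
  "max_chord_cliques n \<epsilon> =
    {X \<in> chord_cliques n \<epsilon>. \<forall>Y \<in> chord_cliques n \<epsilon>. X \<subseteq> Y \<longrightarrow> Y = X}"

definition chord_step :: "nat \<Rightarrow> (nat \<Rightarrow> sign) \<Rightarrow> (nat \<times> nat) set rel" where
  "chord_step n \<epsilon> = {(X, Y). X \<in> max_chord_cliques n \<epsilon> \<and> Y \<in> max_chord_cliques n \<epsilon> \<and>
     (\<exists>x\<in>X. \<exists>y. Y = (X - {x}) \<union> {y} \<and> chord_cw \<epsilon> x y)}"

text \<open>The position of a vertex in the cyclic order around the polygon, starting at vertex \<open>0\<close>
  along the upper side and returning along the lower one.\<close>

definition pos :: "nat \<Rightarrow> (nat \<Rightarrow> sign) \<Rightarrow> nat \<Rightarrow> int" where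
  "pos n \<epsilon> k = (if k = 0 \<or> k = n + 1 \<or> \<epsilon> k = Plus then int k else 2 * int (n + 1) - int k)"

text \<open>Interleaving of two pairs on a circle cut open into a line, the combinatorial form of
  crossing; a shared end never counts.\<close>

definition separates :: "int \<Rightarrow> int \<Rightarrow> int \<Rightarrow> int \<Rightarrow> bool" where
  "separates a b c d \<longleftrightarrow>
    (min a b < c \<and> c < max a b \<and> (d < min a b \<or> max a b < d)) \<or>
    (min a b < d \<and> d < max a b \<and> (c < min a b \<or> max a b < c))"

lemma chord_cw_irrefl: "\<not> chord_cw \<epsilon> x x"
  by (auto simp: chord_cw_def)

text \<open>Arithmetic core of \<open>chord_cw_iff_separates\<close>. A flag marks a point on the
  upper side, other points being reflected; once the flags are fixed, the claim is linear integer
  arithmetic. Lower points stay off the two extreme positions, and equal indices carry equal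
  flags.\<close>

lemma separates_reflect_iff:
  fixes i j k l N :: int and a b c d :: bool
  assumes "0 \<le> i" "i < j" "j \<le> N" "0 \<le> k" "k < l" "l \<le> N"
    and "a \<or> 0 < i" "b \<or> j < N" "c \<or> 0 < k" "d \<or> l < N"
    and "i = k \<Longrightarrow> a = c" "i = l \<Longrightarrow> a = d" "j = k \<Longrightarrow> b = c" "j = l \<Longrightarrow> b = d"
  shows "separates (if a then i else 2 * N - i) (if b then j else 2 * N - j)
      (if c then k else 2 * N - k) (if d then l else 2 * N - l) \<longleftrightarrow>
    i < l \<and> k < j \<and> (i < k \<and> \<not> c \<or> k < i \<and> a) \<and> (l < j \<and> d \<or> j < l \<and> \<not> b) \<or>
    k < j \<and> i < l \<and> (k < i \<and> \<not> a \<or> i < k \<and> c) \<and> (j < l \<and> b \<or> l < j \<and> \<not> d)"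
  using assms
  by (cases a; cases b; cases c; cases d; simp add: separates_def min_def max_def; presburger)

text \<open>Forgetting the direction turns the clockwise relation into interleaving on a circle,
  where the quadrilateral argument is a statement about positions only.\<close>

lemma chord_cw_iff_separates:
  assumes "(i, j) \<in> chords n" "(k, l) \<in> chords n"
  shows "chord_cw \<epsilon> (i, j) (k, l) \<or> chord_cw \<epsilon> (k, l) (i, j) \<longleftrightarrow>
    separates (pos n \<epsilon> i) (pos n \<epsilon> j) (pos n \<epsilon> k) (pos n \<epsilon> l)"
proof -
  \<comment> \<open>Like \<open>pos\<close>, this puts \<open>0\<close> and \<open>n + 1\<close> on
    the upper side whatever \<open>\<epsilon>\<close> says there; \<open>chord_cw\<close> reads
    signs only strictly between them.\<close>
  define up where "up m \<longleftrightarrow> m = 0 \<or> m = n + 1 \<or> \<epsilon> m = Plus" for m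
  have ij: "i < j" "j \<le> n + 1" "k < l" "l \<le> n + 1" using assms by (auto simp: chords_def)
  have sign: "\<epsilon> m = Plus \<longleftrightarrow> up m" "\<epsilon> m = Minus \<longleftrightarrow> \<not> up m" if "0 < m" "m < n + 1" for m
    using that by (auto simp: up_def sign_neq)
  have "chord_cw \<epsilon> (i, j) (k, l) \<longleftrightarrow> i < l \<and> k < j \<and>
      (i < k \<and> \<not> up k \<or> k < i \<and> up i) \<and> (l < j \<and> up l \<or> j < l \<and> \<not> up j)"
    using ij sign[of i] sign[of j] sign[of k] sign[of l] by (auto simp: chord_cw_def)
  moreover have "chord_cw \<epsilon> (k, l) (i, j) \<longleftrightarrow> k < j \<and> i < l \<and>
      (k < i \<and> \<not> up i \<or> i < k \<and> up k) \<and> (j < l \<and> up j \<or> l < j \<and> \<not> up l)"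
    using ij sign[of i] sign[of j] sign[of k] sign[of l] by (auto simp: chord_cw_def)
  moreover have "separates (pos n \<epsilon> i) (pos n \<epsilon> j) (pos n \<epsilon> k) (pos n \<epsilon> l) \<longleftrightarrow>
      int i < int l \<and> int k < int j \<and>
        (int i < int k \<and> \<not> up k \<or> int k < int i \<and> up i) \<and>
        (int l < int j \<and> up l \<or> int j < int l \<and> \<not> up j) \<or>
      int k < int j \<and> int i < int l \<and>
        (int k < int i \<and> \<not> up i \<or> int i < int k \<and> up k) \<and>
        (int j < int l \<and> up j \<or> int l < int j \<and> \<not> up l)"
    unfolding pos_def up_def[symmetric]
    by (rule separates_reflect_iff) (use ij in \<open>auto simp: up_def\<close>)
  ultimately show ?thesis by simp
qed

text \<open>With crossing diagonals \<open>ab\<close> and \<open>cd\<close>, \<open>ac\<close> is a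
  side of their quadrilateral. A chord \<open>uv\<close> across it has one end in the arc cut off by
  \<open>ac\<close>; its other end then lies beyond \<open>ab\<close> or beyond
  \<open>cd\<close>.\<close>

lemma separates_quadrilateral:
  assumes "separates a b c d" "separates a c u v"
  shows "separates a b u v \<or> separates c d u v"
  using assms unfolding separates_def min_def max_def by smt

lemma separates_commute:
  "separates a b c d \<longleftrightarrow> separates b a c d" "separates a b c d \<longleftrightarrow> separates a b d c"
  by (auto simp: separates_def min_def max_def)

lemma separates_neq:
  assumes "separates a b c d"
  shows "a \<noteq> c" "a \<noteq> d" "b \<noteq> c" "b \<noteq> d"
  using assms by (auto simp: separates_def min_def max_def split: if_splits)

lemma max_chord_cliqueI:
  assumes X: "X \<in> max_chord_cliques n \<epsilon>" and e: "e \<in> chords n"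
    and cw: "\<And>x. x \<in> X \<Longrightarrow> \<not> chord_cw \<epsilon> e x \<and> \<not> chord_cw \<epsilon> x e"
  shows "e \<in> X"
proof -
  have "insert e X \<in> chord_cliques n \<epsilon>"
    using X e cw chord_cw_irrefl by (auto simp: max_chord_cliques_def chord_cliques_def)
  then have "insert e X = X" using X by (auto simp: max_chord_cliques_def)
  then show ?thesis by blast
qed

text \<open>A member \<open>z\<close> of \<open>X\<close> crossing the side \<open>ac\<close> would
  cross \<open>x\<close> or \<open>y\<close>. But \<open>z\<close> differs from \<open>x\<close>,
  which shares the end \<open>a\<close> with that side, so \<open>z\<close> lies in both
  \<open>X\<close> and \<open>Y\<close> and crosses neither. Maximality then puts the side into
  \<open>X\<close>.\<close>

lemma chord_step_quadrilateral:
  assumes X: "X \<in> max_chord_cliques n \<epsilon>" and Y: "Y \<in> max_chord_cliques n \<epsilon>"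
    and xy: "x \<in> X" "Y = (X - {x}) \<union> {y}"
    and cross: "chord_cw \<epsilon> x y \<or> chord_cw \<epsilon> y x"
    and a: "a \<in> ends x" and c: "c \<in> ends y"
  shows "a \<noteq> c \<and> (min a c, max a c) \<in> X"
proof -
  let ?s = "\<lambda>i j k l. separates (pos n \<epsilon> i) (pos n \<epsilon> j) (pos n \<epsilon> k) (pos n \<epsilon> l)"
  have xc: "x \<in> chords n" "y \<in> chords n"
    using X Y xy by (auto simp: max_chord_cliques_def chord_cliques_def)
  obtain b where b: "x = (a, b) \<or> x = (b, a)" using a by (cases x) (auto simp: ends_def)
  obtain d where d: "y = (c, d) \<or> y = (d, c)" using c by (cases y) (auto simp: ends_def)
  have s: "?s a b c d"
    using cross chord_cw_iff_separates[of "fst x" "snd x" n "fst y" "snd y" \<epsilon>] xc b d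
    by (auto simp: separates_commute)
  then have ac: "a \<noteq> c" using separates_neq(1) by metis
  then have e: "(min a c, max a c) \<in> chords n"
    using xc b d by (auto simp: chords_def min_def max_def)
  have "\<not> chord_cw \<epsilon> (min a c, max a c) z \<and> \<not> chord_cw \<epsilon> z (min a c, max a c)" if z: "z \<in> X" for z
  proof (rule ccontr)
    obtain u v where uv: "z = (u, v)" by (cases z)
    have zc: "(u, v) \<in> chords n" using X z uv by (auto simp: max_chord_cliques_def chord_cliques_def)
    assume "\<not> ?thesis"
    then have "?s (min a c) (max a c) u v"
      using chord_cw_iff_separates[OF e zc] uv by blast
    then have s': "?s a c u v" by (auto simp: min_def max_def separates_commute split: if_splits)
    with s have "?s a b u v \<or> ?s c d u v" by (rule separates_quadrilateral)
    then have "?s (fst x) (snd x) u v \<or> ?s (fst y) (snd y) u v"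
      using b d by (auto simp: separates_commute)
    then have "chord_cw \<epsilon> x z \<or> chord_cw \<epsilon> z x \<or> chord_cw \<epsilon> y z \<or> chord_cw \<epsilon> z y"
      using chord_cw_iff_separates[of "fst x" "snd x" n u v \<epsilon>]
        chord_cw_iff_separates[of "fst y" "snd y" n u v \<epsilon>] xc zc uv by auto
    moreover have "\<not> chord_cw \<epsilon> x z" "\<not> chord_cw \<epsilon> z x"
      using X xy z by (auto simp: max_chord_cliques_def chord_cliques_def)
    moreover have "\<not> chord_cw \<epsilon> y z" "\<not> chord_cw \<epsilon> z y" if "z \<noteq> x"
      using Y xy z that by (auto simp: max_chord_cliques_def chord_cliques_def)
    moreover have "z \<noteq> x"
      using separates_neq(1,2)[OF s'] b uv by auto
    ultimately show False by blast
  qed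
  with max_chord_cliqueI[OF X e] ac show ?thesis by blast
qed

section \<open>Chords of the polygon\<close>

definition line :: "(nat \<Rightarrow> real \<times> real) \<Rightarrow> nat \<Rightarrow> nat \<Rightarrow> real \<Rightarrow> real" where
  "line p i j x = snd (p i) + slope p i j * (x - fst (p i))"

lemma line_left [simp]: "line p i j (fst (p i)) = snd (p i)"
  by (simp add: line_def)

lemma line_right [simp]: "fst (p i) < fst (p j) \<Longrightarrow> line p i j (fst (p j)) = snd (p j)"
  by (simp add: line_def slope_def)

lemma slope_commute: "slope p i j = slope p j i"
  unfolding slope_def by (metis minus_diff_eq minus_divide_divide)

text \<open>A segment that is not vertical is the graph of an affine function; the convex parameter
  of a point is its relative horizontal position.\<close>

lemma open_segment_iff_line:
  assumes "fst (p i) < fst (p j)"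
  shows "z \<in> open_segment (p i) (p j) \<longleftrightarrow>
    fst (p i) < fst z \<and> fst z < fst (p j) \<and> snd z = line p i j (fst z)"
proof
  let ?d = "fst (p j) - fst (p i)"
  assume "z \<in> open_segment (p i) (p j)"
  then obtain u where u: "0 < u" "u < 1" "z = (1 - u) *\<^sub>R p i + u *\<^sub>R p j"
    by (auto simp: in_segment)
  then have "fst z = (1 - u) * fst (p i) + u * fst (p j)" "snd z = (1 - u) * snd (p i) + u * snd (p j)"
    by simp_all
  then have z: "fst z - fst (p i) = u * ?d" "snd z - snd (p i) = u * (snd (p j) - snd (p i))"
    by (simp_all add: algebra_simps)
  have "0 < u * ?d" "u * ?d < ?d" using u assms by simp_all
  moreover have "slope p i j * (u * ?d) = u * (snd (p j) - snd (p i))"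
    using assms by (simp add: slope_def)
  then have "snd z = line p i j (fst z)" using z(2) unfolding line_def z(1) by linarith
  ultimately show "fst (p i) < fst z \<and> fst z < fst (p j) \<and> snd z = line p i j (fst z)"
    using z(1) by linarith
next
  let ?d = "fst (p j) - fst (p i)"
  assume z: "fst (p i) < fst z \<and> fst z < fst (p j) \<and> snd z = line p i j (fst z)"
  define u where "u = (fst z - fst (p i)) / ?d"
  have u: "0 < u" "u < 1" using z by (simp_all add: u_def)
  have "u * ?d = fst z - fst (p i)" using assms by (simp add: u_def)
  moreover have "u * (snd (p j) - snd (p i)) = snd z - snd (p i)"
    using z by (simp add: u_def line_def slope_def)
  ultimately have "z = (1 - u) *\<^sub>R p i + u *\<^sub>R p j"
    by (simp add: prod_eq_iff algebra_simps)
  with u assms show "z \<in> open_segment (p i) (p j)" by (auto simp: in_segment)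
qed

lemma line_diff_affine:
  "(line p k l x - line p i j x) - (line p k l y - line p i j y) = (slope p k l - slope p i j) * (x - y)"
  by (simp add: line_def algebra_simps)

text \<open>Affinity is expressed by the constant difference quotient \<open>c\<close>. Its sign
  fixes the signs of \<open>f\<close> on both sides of a root; the last alternative is the zero
  function.\<close>

lemma affine_root_iff:
  fixes f :: "real \<Rightarrow> real"
  assumes f: "\<And>x y. f x - f y = c * (x - y)" and "a < b"
  shows "(\<exists>x. a < x \<and> x < b \<and> f x = 0) \<longleftrightarrow> f a < 0 \<and> 0 < f b \<or> f b < 0 \<and> 0 < f a \<or> f a = 0 \<and> f b = 0"
    (is "?L \<longleftrightarrow> ?R")
proof
  assume ?L
  then obtain x where x: "a < x" "x < b" "f x = 0" by blast
  then have "f a = c * (a - x)" "f b = c * (b - x)" using f[of a x] f[of b x] by simp_all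
  with x show ?R
    by (cases c "0 :: real" rule: linorder_cases) (auto simp: mult_less_0_iff zero_less_mult_iff)
next
  assume R: ?R
  have c: "f b - f a = c * (b - a)" by (rule f)
  show ?L
  proof (cases "c = 0")
    case True
    then have "f a = 0" using c R by auto
    then have "f ((a + b) / 2) = 0" using f[of "(a + b) / 2" a] True by simp
    with \<open>a < b\<close> show ?thesis by (intro exI[of _ "(a + b) / 2"]) simp
  next
    case False
    \<comment> \<open>This is where the line through \<open>(a, f a)\<close> of slope
      \<open>c\<close> meets the axis.\<close>
    define x where "x = a - f a / c"
    have "f x = 0" using f[of x a] False by (simp add: x_def)
    then have "f a = c * (a - x)" "f b = c * (b - x)" using f[of a x] f[of b x] by simp_all
    with R False \<open>a < b\<close> have "a < x \<and> x < b"
      by (auto simp: mult_less_0_iff zero_less_mult_iff)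
    with \<open>f x = 0\<close> show ?thesis by blast
  qed
qed

section \<open>Vertices of a Cambrian polygon and the lines through them\<close>

locale cambrian =
  fixes n :: nat and \<epsilon> :: "nat \<Rightarrow> sign" and p :: "nat \<Rightarrow> real \<times> real"
  assumes cambrian: "cambrian_polygon n \<epsilon> p"
begin

lemma fst_less: "i < j \<Longrightarrow> j \<le> n + 1 \<Longrightarrow> fst (p i) < fst (p j)"
  using cambrian by (auto simp: cambrian_polygon_def)

lemma vertex_eq_iff: "i \<le> n + 1 \<Longrightarrow> j \<le> n + 1 \<Longrightarrow> p i = p j \<longleftrightarrow> i = j"
  by (metis fst_less less_irrefl linorder_less_linear)

lemma vertex_extreme: "i \<le> n + 1 \<Longrightarrow> p i extreme_point_of polygon n p"
  using cambrian by (auto simp: cambrian_polygon_def)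

lemma vertex_in_polygon: "i \<le> n + 1 \<Longrightarrow> p i \<in> polygon n p"
  by (intro hull_inc) auto

lemma open_segment_subset_polygon:
  assumes "i \<le> n + 1" "j \<le> n + 1"
  shows "open_segment (p i) (p j) \<subseteq> polygon n p"
  using closed_segment_subset[OF vertex_in_polygon[OF assms(1)] vertex_in_polygon[OF assms(2)]
      convex_convex_hull] segment_open_subset_closed by blast

lemma vertex_not_in_open_segment:
  assumes "k \<le> n + 1" "a \<in> polygon n p" "b \<in> polygon n p"
  shows "p k \<notin> open_segment a b"
  using vertex_extreme[OF assms(1)] assms(2,3) unfolding extreme_point_of_def by blast

text \<open>Extremality of a vertex, applied to a vertical segment through it.\<close>

lemma vertex_not_vertically_between:
  assumes "k \<le> n + 1" "(fst (p k), y) \<in> polygon n p" "(fst (p k), z) \<in> polygon n p"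
    and "y < snd (p k)" "snd (p k) < z"
  shows False
proof -
  define u where "u = (snd (p k) - y) / (z - y)"
  have u: "0 < u" "u < 1" using assms(4,5) by (simp_all add: u_def)
  have "u * (z - y) = snd (p k) - y" using assms(4,5) by (simp add: u_def)
  then have "p k = (1 - u) *\<^sub>R (fst (p k), y) + u *\<^sub>R (fst (p k), z)"
    by (simp add: prod_eq_iff algebra_simps)
  then have "p k \<in> open_segment (fst (p k), y) (fst (p k), z)"
    using u assms(4,5) by (auto simp: in_segment)
  with vertex_not_in_open_segment[OF assms(1-3)] show False by blast
qed

text \<open>If the sign is \<open>Plus\<close>, the segment from \<open>p 0\<close> to
  \<open>p (n + 1)\<close> passes below \<open>p k\<close>, so a chord passing above would leave
  \<open>p k\<close> strictly between two points of the polygon. The chord cannot pass through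
  \<open>p k\<close> either, an extreme point. \<open>Minus\<close> is the mirror case.\<close>

lemma vertex_line_iff:
  assumes "i < k" "k < j" "j \<le> n + 1"
  shows "line p i j (fst (p k)) < snd (p k) \<longleftrightarrow> \<epsilon> k = Plus"
    and "snd (p k) < line p i j (fst (p k)) \<longleftrightarrow> \<epsilon> k = Minus"
proof -
  \<comment> \<open>These are the points of the chord and of the base segment on the vertical line
    through \<open>p k\<close>.\<close>
  let ?q = "(fst (p k), line p i j (fst (p k)))" and ?r = "(fst (p k), snd (p 0))"
  have le: "i \<le> n + 1" "j \<le> n + 1" "k \<le> n + 1" using assms by linarith+
  have q: "?q \<in> open_segment (p i) (p j)"
    using assms by (subst open_segment_iff_line) (auto intro!: fst_less)
  have ne: "snd (p k) \<noteq> line p i j (fst (p k))"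
  proof
    assume "snd (p k) = line p i j (fst (p k))"
    then have "?q = p k" by (simp add: prod_eq_iff)
    with q show False using vertex_not_in_open_segment le vertex_in_polygon by metis
  qed
  have "slope p 0 (n + 1) = 0" using cambrian by (simp add: slope_def cambrian_polygon_def)
  then have "?r \<in> open_segment (p 0) (p (n + 1))"
    using assms by (subst open_segment_iff_line) (auto simp: line_def intro!: fst_less)
  then have r: "?r \<in> polygon n p" using open_segment_subset_polygon[of 0 "n + 1"] by auto
  have q': "?q \<in> polygon n p" using q open_segment_subset_polygon[OF le(1,2)] by blast
  have k: "case \<epsilon> k of Plus \<Rightarrow> snd (p 0) < snd (p k) | Minus \<Rightarrow> snd (p k) < snd (p 0)"
    using cambrian assms unfolding cambrian_polygon_def by simp
  have plus: "line p i j (fst (p k)) < snd (p k)" if "\<epsilon> k = Plus"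
  proof (rule ccontr)
    assume "\<not> ?thesis"
    moreover have "snd (p 0) < snd (p k)" using k that by simp
    ultimately show False using vertex_not_vertically_between[OF le(3) r q'] ne by linarith
  qed
  have minus: "snd (p k) < line p i j (fst (p k))" if "\<epsilon> k = Minus"
  proof (rule ccontr)
    assume "\<not> ?thesis"
    moreover have "snd (p k) < snd (p 0)" using k that by simp
    ultimately show False using vertex_not_vertically_between[OF le(3) q' r] ne by linarith
  qed
  from plus minus show "line p i j (fst (p k)) < snd (p k) \<longleftrightarrow> \<epsilon> k = Plus"
    "snd (p k) < line p i j (fst (p k)) \<longleftrightarrow> \<epsilon> k = Minus"
    by (cases "\<epsilon> k"; fastforce)+
qed

text \<open>One of the chords starts at the left end of the common range, so the comparison asks on
  which side of the other chord its first vertex lies.\<close>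

lemma lines_left:
  assumes "(i, j) \<in> chords n" "(k, l) \<in> chords n" "max i k < min j l"
  shows "line p k l (fst (p (max i k))) < line p i j (fst (p (max i k))) \<longleftrightarrow>
    i < k \<and> \<epsilon> k = Minus \<or> k < i \<and> \<epsilon> i = Plus"
  using assms vertex_line_iff(2)[of i k j] vertex_line_iff(1)[of k i l]
  by (cases i k rule: linorder_cases) (auto simp: chords_def max_def)

lemma lines_right:
  assumes "(i, j) \<in> chords n" "(k, l) \<in> chords n" "max i k < min j l"
  shows "line p i j (fst (p (min j l))) < line p k l (fst (p (min j l))) \<longleftrightarrow>
    l < j \<and> \<epsilon> l = Plus \<or> j < l \<and> \<epsilon> j = Minus"
  using assms vertex_line_iff(1)[of i l j] vertex_line_iff(2)[of k j l]
    line_right[of p i j, OF fst_less] line_right[of p k l, OF fst_less]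
  by (cases j l rule: linorder_cases) (auto simp: chords_def min_def)

lemma chord_cw_iff_lines:
  assumes "(i, j) \<in> chords n" "(k, l) \<in> chords n"
  shows "chord_cw \<epsilon> (i, j) (k, l) \<longleftrightarrow> max i k < min j l \<and>
    line p k l (fst (p (max i k))) - line p i j (fst (p (max i k))) < 0 \<and>
    0 < line p k l (fst (p (min j l))) - line p i j (fst (p (min j l)))"
  using lines_left[OF assms] lines_right[OF assms] by (auto simp: chord_cw_def)

text \<open>The difference of the two lines passes from negative to positive, so its slope is
  positive.\<close>

lemma chord_cw_imp_slope_less:
  assumes "(i, j) \<in> chords n" "(k, l) \<in> chords n" "chord_cw \<epsilon> (i, j) (k, l)"
  shows "slope p i j < slope p k l"
proof -
  from chord_cw_iff_lines[OF assms(1,2)] assms(3)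
  have *: "max i k < min j l"
    "line p k l (fst (p (max i k))) - line p i j (fst (p (max i k))) < 0"
    "0 < line p k l (fst (p (min j l))) - line p i j (fst (p (min j l)))" by blast+
  with line_diff_affine[of p k l "fst (p (min j l))" i j "fst (p (max i k))"]
  have "0 < (slope p k l - slope p i j) * (fst (p (min j l)) - fst (p (max i k)))" by linarith
  moreover have "fst (p (max i k)) < fst (p (min j l))"
    using assms(1) *(1) by (intro fst_less) (auto simp: chords_def)
  ultimately show ?thesis by (simp add: zero_less_mult_iff)
qed

text \<open>Over the common \<open>x\<close>-range the segments meet where the affine difference
  \<open>f\<close> vanishes. Its two strict sign changes are the two clockwise relations, and for
  different chords \<open>f\<close> cannot vanish at both ends.\<close>

lemma open_segments_meet_iff:
  assumes c: "(i, j) \<in> chords n" "(k, l) \<in> chords n" and ne: "(i, j) \<noteq> (k, l)"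
  shows "open_segment (p i) (p j) \<inter> open_segment (p k) (p l) \<noteq> {} \<longleftrightarrow>
    chord_cw \<epsilon> (i, j) (k, l) \<or> chord_cw \<epsilon> (k, l) (i, j)"
proof -
  let ?a = "fst (p (max i k))" and ?b = "fst (p (min j l))"
  define f where "f x = line p k l x - line p i j x" for x
  have less: "fst (p i) < fst (p j)" "fst (p k) < fst (p l)"
    using c by (auto simp: chords_def intro!: fst_less)
  have mono: "fst (p u) \<le> fst (p v) \<longleftrightarrow> u \<le> v" if "u \<le> n + 1" "v \<le> n + 1" for u v
    using fst_less[of u v] fst_less[of v u] that by (cases u v rule: linorder_cases) auto
  have le: "i \<le> n + 1" "j \<le> n + 1" "k \<le> n + 1" "l \<le> n + 1"
    using c by (auto simp: chords_def)
  have "?a = max (fst (p i)) (fst (p k))"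
    using mono[OF le(1,3)] by (cases "i \<le> k") simp_all
  then have a: "?a < x \<longleftrightarrow> fst (p i) < x \<and> fst (p k) < x" for x by simp
  have "?b = min (fst (p j)) (fst (p l))"
    using mono[OF le(2,4)] by (cases "j \<le> l") simp_all
  then have b: "x < ?b \<longleftrightarrow> x < fst (p j) \<and> x < fst (p l)" for x by simp
  have ab: "?a < ?b \<longleftrightarrow> max i k < min j l"
    using mono[of "min j l" "max i k"] le by (auto simp: not_le[symmetric])
  have "open_segment (p i) (p j) \<inter> open_segment (p k) (p l) \<noteq> {} \<longleftrightarrow>
      (\<exists>z. ?a < fst z \<and> fst z < ?b \<and> snd z = line p i j (fst z) \<and> snd z = line p k l (fst z))"
    unfolding ex_in_conv[symmetric] Int_iff a b open_segment_iff_line[of p i j, OF less(1)]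
      open_segment_iff_line[of p k l, OF less(2)] by blast
  also have "\<dots> \<longleftrightarrow> (\<exists>x. ?a < x \<and> x < ?b \<and> f x = 0)"
    by (auto simp: f_def)
  also have "\<dots> \<longleftrightarrow> chord_cw \<epsilon> (i, j) (k, l) \<or> chord_cw \<epsilon> (k, l) (i, j)"
  proof (cases "?a < ?b")
    case True
    then have m: "max i k < min j l" "max k i < min l j" using ab by (auto simp: max.commute min.commute)
    have "f ?a \<noteq> 0 \<or> f ?b \<noteq> 0"
    proof (rule ccontr)
      assume "\<not> ?thesis"
      then have eq: "line p k l ?a = line p i j ?a" "line p k l ?b = line p i j ?b"
        by (auto simp: f_def)
      \<comment> \<open>Equal heights exclude both signs at an end that only one chord has, so the
        chords coincide.\<close>
      then have "\<not> (i < k \<and> \<epsilon> k = Minus \<or> k < i \<and> \<epsilon> i = Plus)"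
          "\<not> (k < i \<and> \<epsilon> i = Minus \<or> i < k \<and> \<epsilon> k = Plus)"
          "\<not> (l < j \<and> \<epsilon> l = Plus \<or> j < l \<and> \<epsilon> j = Minus)"
          "\<not> (j < l \<and> \<epsilon> j = Plus \<or> l < j \<and> \<epsilon> l = Minus)"
        using lines_left[OF c m(1)] lines_left[OF c(2,1) m(2)]
          lines_right[OF c m(1)] lines_right[OF c(2,1) m(2)]
        by (simp_all add: max.commute min.commute)
      then have "i = k" "j = l" using sign_neq by (metis linorder_neqE_nat)+
      with ne show False by simp
    qed
    moreover have "(\<exists>x. ?a < x \<and> x < ?b \<and> f x = 0) \<longleftrightarrow>
        f ?a < 0 \<and> 0 < f ?b \<or> f ?b < 0 \<and> 0 < f ?a \<or> f ?a = 0 \<and> f ?b = 0"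
      by (rule affine_root_iff[OF _ True, of _ "slope p k l - slope p i j"])
        (simp add: f_def line_diff_affine)
    moreover have "chord_cw \<epsilon> (i, j) (k, l) \<longleftrightarrow> f ?a < 0 \<and> 0 < f ?b"
      using m unfolding chord_cw_iff_lines[OF c] f_def by simp
    moreover have "chord_cw \<epsilon> (k, l) (i, j) \<longleftrightarrow> f ?b < 0 \<and> 0 < f ?a"
      using m unfolding chord_cw_iff_lines[OF c(2,1)] f_def by (auto simp: max.commute min.commute)
    ultimately show ?thesis by blast
  next
    case False
    then have "\<not> max i k < min j l" using ab by simp
    then have "\<not> (chord_cw \<epsilon> (i, j) (k, l) \<or> chord_cw \<epsilon> (k, l) (i, j))"
      by (auto simp: chord_cw_def)
    moreover have "\<not> (\<exists>x. ?a < x \<and> x < ?b \<and> f x = 0)" using False by (meson less_trans)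
    ultimately show ?thesis by blast
  qed
  finally show ?thesis .
qed

section \<open>Noncrossing sets of diagonals and cliques of chords\<close>

lemma inj_on_ends: "inj_on ends (chords n)"
  by (rule inj_onI) (auto simp: chords_def ends_def doubleton_eq_iff)

lemma ends_image: "ends ` chords n = {{i, j} | i j. i \<le> n + 1 \<and> j \<le> n + 1 \<and> i \<noteq> j}"
proof (intro equalityI subsetI)
  fix e assume "e \<in> {{i, j} | i j. i \<le> n + 1 \<and> j \<le> n + 1 \<and> i \<noteq> j}"
  then obtain i j where "e = {i, j}" "i \<le> n + 1" "j \<le> n + 1" "i \<noteq> j" by blast
  then have "e = ends (min i j, max i j)" "(min i j, max i j) \<in> chords n"
    by (auto simp: chords_def ends_def min_def max_def)
  then show "e \<in> ends ` chords n" by blast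
qed (force simp: chords_def ends_def)

lemma diagonals_eq: "diagonals n p = ends ` chords n - sides n p"
  by (simp add: diagonals_def ends_image)

lemma crossing_iff:
  assumes "x \<in> chords n" "y \<in> chords n" "x \<noteq> y"
  shows "crossing p (ends x) (ends y) \<longleftrightarrow> chord_cw \<epsilon> x y \<or> chord_cw \<epsilon> y x"
proof -
  obtain i j k l where xy: "x = (i, j)" "y = (k, l)" by (cases x, cases y)
  have "crossing p {i, j} {k, l} \<longleftrightarrow> open_segment (p i) (p j) \<inter> open_segment (p k) (p l) \<noteq> {}"
  proof
    assume "crossing p {i, j} {k, l}"
    then obtain a b c d where *: "{i, j} = {a, b}" "{k, l} = {c, d}"
      and meet: "open_segment (p a) (p b) \<inter> open_segment (p c) (p d) \<noteq> {}"
      unfolding crossing_def by blast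
    \<comment> \<open>Naming the ends in the opposite order gives the same segment.\<close>
    from * have "open_segment (p a) (p b) = open_segment (p i) (p j)"
      "open_segment (p c) (p d) = open_segment (p k) (p l)"
      by (metis doubleton_eq_iff open_segment_commute)+
    with meet show "open_segment (p i) (p j) \<inter> open_segment (p k) (p l) \<noteq> {}" by simp
  next
    assume "open_segment (p i) (p j) \<inter> open_segment (p k) (p l) \<noteq> {}"
    then show "crossing p {i, j} {k, l}" unfolding crossing_def by blast
  qed
  with open_segments_meet_iff assms xy show ?thesis by (simp add: ends_def)
qed

text \<open>A face containing an interior point of a segment contains its ends. A chord crossing a
  side would thus have both ends in that side; being extreme, they could only be the ends of the
  side.\<close>

lemma side_not_crossing:
  assumes "x \<in> chords n" "y \<in> chords n" "ends x \<in> sides n p"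
  shows "\<not> chord_cw \<epsilon> x y" "\<not> chord_cw \<epsilon> y x"
proof -
  obtain i j k l where xy: "x = (i, j)" "y = (k, l)" by (cases x, cases y)
  have le: "i \<le> n + 1" "j \<le> n + 1" "k \<le> n + 1" "l \<le> n + 1" and "i < j" "k < l"
    using assms by (auto simp: chords_def xy)
  have "\<not> (chord_cw \<epsilon> x y \<or> chord_cw \<epsilon> y x)"
  proof
    assume cw: "chord_cw \<epsilon> x y \<or> chord_cw \<epsilon> y x"
    then have ne: "(i, j) \<noteq> (k, l)" by (auto simp: xy chord_cw_def)
    from assms(3) have face: "closed_segment (p i) (p j) face_of polygon n p"
      by (auto simp: sides_def ends_def xy doubleton_eq_iff closed_segment_commute)
    obtain z where z: "z \<in> open_segment (p i) (p j)" "z \<in> open_segment (p k) (p l)"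
      using cw open_segments_meet_iff[of i j k l] assms ne xy by blast
    have "p k \<in> closed_segment (p i) (p j)" "p l \<in> closed_segment (p i) (p j)"
      using face_ofD[OF face z(2) vertex_in_polygon[OF le(3)] vertex_in_polygon[OF le(4)]]
        z(1) segment_open_subset_closed by blast+
    then have "p k \<in> {p i, p j}" "p l \<in> {p i, p j}"
      using vertex_not_in_open_segment[OF le(3) vertex_in_polygon[OF le(1)] vertex_in_polygon[OF le(2)]]
        vertex_not_in_open_segment[OF le(4) vertex_in_polygon[OF le(1)] vertex_in_polygon[OF le(2)]]
      by (auto simp: open_segment_def)
    then have "k \<in> {i, j}" "l \<in> {i, j}" using vertex_eq_iff le by auto
    with ne \<open>i < j\<close> \<open>k < l\<close> show False by auto
  qed
  then show "\<not> chord_cw \<epsilon> x y" "\<not> chord_cw \<epsilon> y x" by blast+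
qed

lemma crossing_free_ends:
  assumes "X \<in> chord_cliques n \<epsilon>"
  shows "noncrossing n p (ends ` X - sides n p)"
  unfolding noncrossing_def
proof (intro conjI pairwiseI)
  show "ends ` X - sides n p \<subseteq> diagonals n p"
    using assms by (auto simp: diagonals_eq chord_cliques_def)
  fix d e assume de: "d \<in> ends ` X - sides n p" "e \<in> ends ` X - sides n p" "d \<noteq> e"
  then obtain x y where "x \<in> X" "y \<in> X" "x \<noteq> y" "d = ends x" "e = ends y" by blast
  with assms show "\<not> crossing p d e"
    using crossing_iff[of x y] unfolding chord_cliques_def by blast
qed

text \<open>All sides are put back, since a maximal clique contains them; this makes
  \<open>chords_of\<close> inverse to taking ends and dropping sides.\<close>

definition chords_of :: "nat set set \<Rightarrow> (nat \<times> nat) set" where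
  "chords_of T = {x \<in> chords n. ends x \<in> T \<union> sides n p}"

lemma chords_of_clique:
  assumes "noncrossing n p T"
  shows "chords_of T \<in> chord_cliques n \<epsilon>"
proof -
  have "\<not> chord_cw \<epsilon> x y" if xy: "x \<in> chords_of T" "y \<in> chords_of T" for x y
  proof
    assume cw: "chord_cw \<epsilon> x y"
    have c: "x \<in> chords n" "y \<in> chords n" using xy by (auto simp: chords_of_def)
    have ne: "x \<noteq> y" using cw chord_cw_irrefl by metis
    \<comment> \<open>Crossing chords are not sides, so both come from \<open>T\<close>.\<close>
    have "ends x \<in> T" "ends y \<in> T"
      using xy cw side_not_crossing(1)[OF c] side_not_crossing(2)[OF c(2,1)]
      unfolding chords_of_def by blast+
    moreover have "ends x \<noteq> ends y" using inj_onD[OF inj_on_ends _ c] ne by blast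
    ultimately have "\<not> crossing p (ends x) (ends y)"
      using assms unfolding noncrossing_def pairwise_def by blast
    with cw crossing_iff[OF c ne] show False by blast
  qed
  then show ?thesis by (auto simp: chord_cliques_def chords_of_def)
qed

lemma side_in_max_chord_clique:
  assumes "X \<in> max_chord_cliques n \<epsilon>" "x \<in> chords n" "ends x \<in> sides n p"
  shows "x \<in> X"
  using assms(1,2)
proof (rule max_chord_cliqueI)
  fix y assume "y \<in> X"
  then have "y \<in> chords n" using assms(1) by (auto simp: max_chord_cliques_def chord_cliques_def)
  with side_not_crossing[OF assms(2) this assms(3)]
  show "\<not> chord_cw \<epsilon> x y \<and> \<not> chord_cw \<epsilon> y x" by blast
qed

lemma max_chord_clique_subset: "X \<in> max_chord_cliques n \<epsilon> \<Longrightarrow> X \<subseteq> chords n"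
  by (auto simp: max_chord_cliques_def chord_cliques_def)

lemma chords_of_ends:
  assumes "X \<in> max_chord_cliques n \<epsilon>"
  shows "chords_of (ends ` X - sides n p) = X"
proof (intro equalityI subsetI)
  fix x assume "x \<in> chords_of (ends ` X - sides n p)"
  then have x: "x \<in> chords n" "ends x \<in> ends ` X \<or> ends x \<in> sides n p"
    by (auto simp: chords_of_def)
  show "x \<in> X"
  proof (cases "ends x \<in> sides n p")
    case True
    with assms x show ?thesis by (metis side_in_max_chord_clique)
  next
    case False
    with x obtain y where "y \<in> X" "ends x = ends y" by blast
    with inj_onD[OF inj_on_ends this(2) x(1)] max_chord_clique_subset[OF assms]
    show ?thesis by blast
  qed
next
  fix x assume "x \<in> X"
  with max_chord_clique_subset[OF assms] show "x \<in> chords_of (ends ` X - sides n p)"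
    unfolding chords_of_def by blast
qed

lemma ends_chords_of:
  assumes "T \<subseteq> diagonals n p"
  shows "ends ` chords_of T - sides n p = T"
  using assms unfolding chords_of_def diagonals_eq by blast

text \<open>Both maps preserve inclusion and the absence of crossings, so a larger set on one side
  would give a larger set on the other, and maximality passes across.\<close>

lemma bij_betw_triangulations:
  "bij_betw (\<lambda>X. ends ` X - sides n p) (max_chord_cliques n \<epsilon>) (triangulations n p)"
proof (rule bij_betw_byWitness[where f' = chords_of])
  show "\<forall>X\<in>max_chord_cliques n \<epsilon>. chords_of (ends ` X - sides n p) = X"
    using chords_of_ends by blast
  show "\<forall>T\<in>triangulations n p. ends ` chords_of T - sides n p = T"
    by (simp add: ends_chords_of triangulations_def noncrossing_def)
  show "(\<lambda>X. ends ` X - sides n p) ` max_chord_cliques n \<epsilon> \<subseteq> triangulations n p"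
  proof (intro image_subsetI)
    fix X assume X: "X \<in> max_chord_cliques n \<epsilon>"
    have "U = ends ` X - sides n p"
      if U: "noncrossing n p U" "ends ` X - sides n p \<subseteq> U" for U
    proof -
      have "X \<subseteq> chords_of U"
        using U(2) chords_of_ends[OF X] unfolding chords_of_def by blast
      then have "chords_of U = X"
        using X chords_of_clique[OF U(1)] unfolding max_chord_cliques_def by blast
      moreover have "ends ` chords_of U - sides n p = U"
        using U(1) by (intro ends_chords_of) (simp add: noncrossing_def)
      ultimately show ?thesis by simp
    qed
    moreover have "noncrossing n p (ends ` X - sides n p)"
      using X by (intro crossing_free_ends) (simp add: max_chord_cliques_def)
    ultimately show "ends ` X - sides n p \<in> triangulations n p"
      unfolding triangulations_def by blast
  qed
  show "chords_of ` triangulations n p \<subseteq> max_chord_cliques n \<epsilon>"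
  proof (intro image_subsetI)
    fix T assume T: "T \<in> triangulations n p"
    then have nT: "noncrossing n p T" by (simp add: triangulations_def)
    have eT: "ends ` chords_of T - sides n p = T"
      using nT by (intro ends_chords_of) (simp add: noncrossing_def)
    have "Y = chords_of T" if Y: "Y \<in> chord_cliques n \<epsilon>" "chords_of T \<subseteq> Y" for Y
    proof -
      have "T \<subseteq> ends ` Y - sides n p" using Y(2) eT by blast
      with T crossing_free_ends[OF Y(1)] have "ends ` Y - sides n p = T"
        unfolding triangulations_def by blast
      then have "Y \<subseteq> chords_of T" using Y(1) unfolding chords_of_def chord_cliques_def by blast
      with Y(2) show ?thesis by blast
    qed
    with chords_of_clique[OF nT] show "chords_of T \<in> max_chord_cliques n \<epsilon>"
      unfolding max_chord_cliques_def by blast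
  qed
qed

section \<open>Flips as exchanges of crossing chords\<close>

lemma slope_ends: "ends x = {a, b} \<Longrightarrow> slope p a b = slope p (fst x) (snd x)"
  unfolding ends_def by (metis doubleton_eq_iff slope_commute)

lemma increasing_flipE:
  assumes "(T, T') \<in> increasing_flip n p"
  obtains a b c d where "{a, b} \<in> T" "T' = (T - {{a, b}}) \<union> {{c, d}}" "slope p a b < slope p c d"
  using assms unfolding increasing_flip_def by blast

text \<open>A step of cliques is a flip because the sides of the quadrilateral of the two chords lie
  in \<open>X\<close>, which gives both triangles. Conversely, exchanged chords must cross, and the
  slopes decide which of them comes first.\<close>

lemma increasing_flip_iff:
  assumes X: "X \<in> max_chord_cliques n \<epsilon>" and Y: "Y \<in> max_chord_cliques n \<epsilon>"
  shows "(ends ` X - sides n p, ends ` Y - sides n p) \<in> increasing_flip n p \<longleftrightarrow> (X, Y) \<in> chord_step n \<epsilon>"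
proof -
  let ?T = "ends ` X - sides n p" and ?T' = "ends ` Y - sides n p"
  note XC = max_chord_clique_subset[OF X] and YC = max_chord_clique_subset[OF Y]
  have tri: "?T \<in> triangulations n p" "?T' \<in> triangulations n p"
    using bij_betwE[OF bij_betw_triangulations] X Y by blast+
  show ?thesis
  proof
    assume "(X, Y) \<in> chord_step n \<epsilon>"
    then obtain x y where x: "x \<in> X" and Yeq: "Y = (X - {x}) \<union> {y}" and cw: "chord_cw \<epsilon> x y"
      unfolding chord_step_def by blast
    have c: "x \<in> chords n" "y \<in> chords n" using x XC YC Yeq by blast+
    have ns: "ends x \<notin> sides n p" "ends y \<notin> sides n p"
      using side_not_crossing(1)[OF c] side_not_crossing(2)[OF c(2,1)] cw by blast+
    have quad: "a \<noteq> c \<and> {a, c} \<in> ?T \<union> sides n p" if "a \<in> ends x" "c \<in> ends y" for a c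
    proof -
      have "a \<noteq> c" and m: "(min a c, max a c) \<in> X"
        using chord_step_quadrilateral[OF X Y x Yeq disjI1[OF cw] that] by simp_all
      moreover have "ends (min a c, max a c) = {a, c}" by (auto simp: ends_def min_def max_def)
      ultimately show ?thesis using m by (metis DiffI UnCI imageI)
    qed
    have tri_x: "triangle n p ?T (fst x) (snd x) c" if "c \<in> ends y" for c
      using quad[of "fst x" c] quad[of "snd x" c] that x c(1)
      by (auto simp: triangle_def chords_def ends_def)
    have "?T' = (?T - {ends x}) \<union> {ends y}"
    proof -
      have "ends ` (X - {x}) = ends ` X - {ends x}"
        using inj_on_image_set_diff[OF inj_on_ends, of X "{x}"] XC c by auto
      then show ?thesis unfolding Yeq image_Un using ns(2) by auto
    qed
    then have "{fst x, snd x} \<in> ?T" "?T' = (?T - {{fst x, snd x}}) \<union> {{fst y, snd y}}"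
      using x ns(1) unfolding ends_def[symmetric] by blast+
    moreover have "triangle n p ?T (fst x) (snd x) (fst y)" "triangle n p ?T (fst x) (snd x) (snd y)"
      by (rule tri_x, simp add: ends_def)+
    moreover have "fst y \<noteq> snd y" using c by (auto simp: chords_def)
    moreover have "slope p (fst x) (snd x) < slope p (fst y) (snd y)"
      using chord_cw_imp_slope_less[of "fst x" "snd x" "fst y" "snd y"] c cw by simp
    ultimately show "(?T, ?T') \<in> increasing_flip n p"
      using tri unfolding increasing_flip_def by blast
  next
    assume "(?T, ?T') \<in> increasing_flip n p"
    then obtain a b c d where ab: "{a, b} \<in> ?T" and T': "?T' = (?T - {{a, b}}) \<union> {{c, d}}"
      and slope: "slope p a b < slope p c d"
      by (rule increasing_flipE)
    obtain x where x: "x \<in> X" "ends x = {a, b}" using ab by blast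
    have "{c, d} \<in> ?T'" using T' by blast
    then obtain y where y: "y \<in> Y" "ends y = {c, d}" by blast
    have xc: "x \<in> chords n" and yc: "y \<in> chords n" using x y XC YC by blast+
    have slope': "slope p (fst x) (snd x) < slope p (fst y) (snd y)"
      using slope slope_ends[OF x(2)] slope_ends[OF y(2)] by simp
    have "\<not> chord_cw \<epsilon> y x"
      using chord_cw_imp_slope_less[of "fst y" "snd y" "fst x" "snd x"] xc yc slope' by auto
    moreover have "chord_cw \<epsilon> x y \<or> chord_cw \<epsilon> y x"
    proof (rule ccontr)
      assume nc: "\<not> ?thesis"
      \<comment> \<open>Without a crossing, \<open>x\<close> is compatible with all of
        \<open>Y\<close> and belongs to it by maximality; then \<open>{a, b} = {c, d}\<close>,
        against the strict inequality of slopes.\<close>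
      have "x \<in> Y"
      proof (rule max_chord_cliqueI[OF Y xc])
        fix z assume z: "z \<in> Y"
        then have zc: "z \<in> chords n" using YC by blast
        consider "ends z \<in> sides n p" | "ends z \<in> ?T" | "ends z = {c, d}"
          using z T' by blast
        then show "\<not> chord_cw \<epsilon> x z \<and> \<not> chord_cw \<epsilon> z x"
        proof cases
          case 1
          with side_not_crossing zc xc show ?thesis by blast
        next
          case 2
          then have "z \<in> chords_of ?T" using zc unfolding chords_of_def by blast
          then have "z \<in> X" by (simp only: chords_of_ends[OF X])
          with x X show ?thesis unfolding max_chord_cliques_def chord_cliques_def by blast
        next
          case 3
          then have "z = y" using inj_onD[OF inj_on_ends _ zc yc] y by simp
          with nc show ?thesis by blast
        qed
      qed
      then have "{a, b} \<in> ?T'" using x(2) ab by blast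
      then have "{a, b} = {c, d}" using T' by blast
      then have "x = y" using inj_onD[OF inj_on_ends _ xc yc] x y by simp
      with slope' show False by simp
    qed
    moreover have "Y = (X - {x}) \<union> {y}"
    proof -
      \<comment> \<open>The exchange is known for sets of diagonals; it is carried back chord by
        chord, the sides lying in both cliques.\<close>
      have "z \<in> Y \<longleftrightarrow> z \<in> (X - {x}) \<union> {y}" if z: "z \<in> chords n" for z
      proof -
        have "z \<in> chords_of ?T' \<longleftrightarrow> ends z \<in> ?T' \<union> sides n p"
          "z \<in> chords_of ?T \<longleftrightarrow> ends z \<in> ?T \<union> sides n p"
          using z unfolding chords_of_def by blast+
        then have "z \<in> Y \<longleftrightarrow> ends z \<in> ?T' \<union> sides n p" "z \<in> X \<longleftrightarrow> ends z \<in> ?T \<union> sides n p"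
          unfolding chords_of_ends[OF X] chords_of_ends[OF Y] by blast+
        moreover have "ends z = {a, b} \<longleftrightarrow> z = x" "ends z = {c, d} \<longleftrightarrow> z = y"
          using inj_onD[OF inj_on_ends _ z xc] inj_onD[OF inj_on_ends _ z yc] x y by auto
        moreover have "ends z = {a, b} \<Longrightarrow> ends z \<notin> sides n p" using ab by simp
        moreover have "ends z \<in> ?T' \<union> sides n p \<longleftrightarrow>
            (ends z \<in> ?T \<and> ends z \<noteq> {a, b} \<or> ends z = {c, d}) \<or> ends z \<in> sides n p"
          unfolding T' by blast
        ultimately show ?thesis by (simp only: Un_iff Diff_iff singleton_iff) blast
      qed
      then show ?thesis using XC YC xc yc by blast
    qed
    ultimately show "(X, Y) \<in> chord_step n \<epsilon>"
      using X Y x(1) unfolding chord_step_def by blast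
  qed
qed

end

section \<open>Cliques of routes\<close>

lemma image_Collect_eq:
  "(\<And>x. x \<in> A \<Longrightarrow> P (f x) \<longleftrightarrow> Q x) \<Longrightarrow> {y \<in> f ` A. P y} = f ` {x \<in> A. Q x}"
  by blast

lemma clique_route_image_iff:
  assumes "X \<subseteq> chords n"
  shows "clique (caracol n) Minf Pinf (caracol_framing n \<epsilon>) (route ` X) \<longleftrightarrow> X \<in> chord_cliques n \<epsilon>"
proof -
  have inj: "inj_on route X" using inj_on_route assms by (rule inj_on_subset)
  have coh: "coherent (caracol n) (caracol_framing n \<epsilon>) (route x) (route y) \<longleftrightarrow>
      \<not> chord_cw \<epsilon> x y \<and> \<not> chord_cw \<epsilon> y x" if "x \<in> X" "y \<in> X" for x y
    using cw_route_iff[of x n y \<epsilon>] cw_route_iff[of y n x \<epsilon>] that assms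
    unfolding coherent_def incoherent_at_def by blast
  have "pairwise (coherent (caracol n) (caracol_framing n \<epsilon>)) (route ` X) \<longleftrightarrow>
      (\<forall>x\<in>X. \<forall>y\<in>X. x \<noteq> y \<longrightarrow> \<not> chord_cw \<epsilon> x y \<and> \<not> chord_cw \<epsilon> y x)"
    using coh inj by (auto simp: pairwise_def inj_on_eq_iff)
  also have "\<dots> \<longleftrightarrow> (\<forall>x\<in>X. \<forall>y\<in>X. \<not> chord_cw \<epsilon> x y)"
    using chord_cw_irrefl by metis
  finally show ?thesis
    using assms unfolding clique_def routes_caracol chord_cliques_def by blast
qed

text \<open>On cliques of chords, taking images under \<open>route\<close> preserves and reflects
  inclusion and reaches every clique of routes, so the maximal elements correspond.\<close>

lemma bij_betw_maximal_cliques: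
  "bij_betw ((`) route) (max_chord_cliques n \<epsilon>)
    (maximal_cliques (caracol n) Minf Pinf (caracol_framing n \<epsilon>))"
proof -
  let ?c = "clique (caracol n) Minf Pinf (caracol_framing n \<epsilon>)"
  have cl: "{C. ?c C} = (`) route ` chord_cliques n \<epsilon>"
  proof (intro equalityI subsetI)
    fix C assume "C \<in> {C. ?c C}"
    then have C: "?c C" by simp
    then obtain X where "X \<subseteq> chords n" "C = route ` X"
      unfolding clique_def routes_caracol subset_image_iff by blast
    with C clique_route_image_iff show "C \<in> (`) route ` chord_cliques n \<epsilon>" by blast
  qed (auto simp: clique_route_image_iff chord_cliques_def)
  have sub: "route ` X \<subseteq> route ` Y \<longleftrightarrow> X \<subseteq> Y"
    if "X \<in> chord_cliques n \<epsilon>" "Y \<in> chord_cliques n \<epsilon>" for X Y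
    using that by (intro inj_on_image_subset_iff[OF inj_on_route]) (auto simp: chord_cliques_def)
  have inj: "inj_on ((`) route) (chord_cliques n \<epsilon>)"
    by (rule inj_onI) (use sub in blast)
  have "maximal_cliques (caracol n) Minf Pinf (caracol_framing n \<epsilon>) =
      {C \<in> {C. ?c C}. \<forall>D \<in> {C. ?c C}. C \<subseteq> D \<longrightarrow> D = C}"
    unfolding maximal_cliques_def by blast
  also have "\<dots> = (`) route ` max_chord_cliques n \<epsilon>"
  proof -
    have "(\<forall>D \<in> (`) route ` chord_cliques n \<epsilon>. route ` X \<subseteq> D \<longrightarrow> D = route ` X) \<longleftrightarrow>
        (\<forall>Y \<in> chord_cliques n \<epsilon>. X \<subseteq> Y \<longrightarrow> Y = X)" if "X \<in> chord_cliques n \<epsilon>" for X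
      unfolding ball_simps(9)
      by (rule ball_cong[OF refl]) (simp only: sub[OF that] inj_on_eq_iff[OF inj _ that])
    then show ?thesis unfolding cl max_chord_cliques_def by (rule image_Collect_eq)
  qed
  finally have "(`) route ` max_chord_cliques n \<epsilon> =
      maximal_cliques (caracol n) Minf Pinf (caracol_framing n \<epsilon>)" ..
  moreover have "inj_on ((`) route) (max_chord_cliques n \<epsilon>)"
    by (rule inj_on_subset[OF inj]) (simp add: max_chord_cliques_def)
  ultimately show ?thesis unfolding bij_betw_def by blast
qed

lemma clique_stepE:
  assumes "(C, C') \<in> clique_step G s t F"
  obtains R R' where "R \<in> C" "C' = (C - {R}) \<union> {R'}" "\<exists>u. cw G F u R R'"
  using assms unfolding clique_step_def by blast

lemma clique_step_iff:
  assumes X: "X \<in> max_chord_cliques n \<epsilon>" and Y: "Y \<in> max_chord_cliques n \<epsilon>"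
  shows "(route ` X, route ` Y) \<in> clique_step (caracol n) Minf Pinf (caracol_framing n \<epsilon>) \<longleftrightarrow>
    (X, Y) \<in> chord_step n \<epsilon>"
proof -
  have XC: "X \<subseteq> chords n" and YC: "Y \<subseteq> chords n"
    using X Y by (auto simp: max_chord_cliques_def chord_cliques_def)
  have max: "route ` X \<in> maximal_cliques (caracol n) Minf Pinf (caracol_framing n \<epsilon>)"
    "route ` Y \<in> maximal_cliques (caracol n) Minf Pinf (caracol_framing n \<epsilon>)"
    using bij_betwE[OF bij_betw_maximal_cliques] X Y by blast+
  have eq: "route ` Y = (route ` X - {route x}) \<union> {route y} \<longleftrightarrow> Y = (X - {x}) \<union> {y}"
    if "x \<in> X" "y \<in> chords n" for x y
  proof -
    have "route ` (X - {x}) = route ` X - {route x}"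
      using inj_on_image_set_diff[OF inj_on_route, of X "{x}"] that XC by auto
    then have "(route ` X - {route x}) \<union> {route y} = route ` ((X - {x}) \<union> {y})"
      by (simp only: image_Un image_insert image_empty)
    moreover have "(X - {x}) \<union> {y} \<subseteq> chords n" using that XC by blast
    ultimately show ?thesis
      using inj_on_image_eq_iff[OF inj_on_route YC, of "(X - {x}) \<union> {y}"] by (simp only:)
  qed
  have cw: "(\<exists>u. cw (caracol n) (caracol_framing n \<epsilon>) u (route x) (route y)) \<longleftrightarrow> chord_cw \<epsilon> x y"
    if "x \<in> X" "y \<in> chords n" for x y
    using that XC by (intro cw_route_iff) auto
  show ?thesis
  proof
    assume "(route ` X, route ` Y) \<in> clique_step (caracol n) Minf Pinf (caracol_framing n \<epsilon>)"
    then obtain Q R where Q: "Q \<in> route ` X" and R: "route ` Y = (route ` X - {Q}) \<union> {R}"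
      and QR: "\<exists>u. cw (caracol n) (caracol_framing n \<epsilon>) u Q R"
      by (rule clique_stepE)
    from Q obtain x where x: "x \<in> X" "Q = route x" by blast
    \<comment> \<open>The new route lies in the second clique, so it comes from a chord.\<close>
    have "R \<in> route ` Y" unfolding R by simp
    then obtain y where "y \<in> Y" and yR: "R = route y" by blast
    then have y: "y \<in> chords n" using YC by blast
    have "Y = (X - {x}) \<union> {y}" using R eq[OF x(1) y] unfolding x(2) yR by (rule iffD1[rotated])
    moreover have "chord_cw \<epsilon> x y" using QR cw[OF x(1) y] unfolding x(2) yR by (rule iffD1[rotated])
    moreover note x(1)
    ultimately show "(X, Y) \<in> chord_step n \<epsilon>" using X Y unfolding chord_step_def by blast
  next
    assume "(X, Y) \<in> chord_step n \<epsilon>"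
    then obtain x y where x: "x \<in> X" "Y = (X - {x}) \<union> {y}" "chord_cw \<epsilon> x y"
      unfolding chord_step_def by blast
    then have y: "y \<in> chords n" using YC by blast
    have "route ` Y = (route ` X - {route x}) \<union> {route y}" using eq[OF x(1) y] x(2) by blast
    moreover have "\<exists>u. cw (caracol n) (caracol_framing n \<epsilon>) u (route x) (route y)"
      using cw[OF x(1) y] x(3) by blast
    ultimately show "(route ` X, route ` Y) \<in> clique_step (caracol n) Minf Pinf (caracol_framing n \<epsilon>)"
      using max x(1) unfolding clique_step_def by blast
  qed
qed

theorem theorem8p1:
  fixes n :: nat and \<epsilon> :: "nat \<Rightarrow> sign" and p :: "nat \<Rightarrow> real \<times> real"
  assumes "n \<ge> 1" and "cambrian_polygon n \<epsilon> p"
  shows "order_isomorphic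
    (maximal_cliques (caracol n) Minf Pinf (caracol_framing n \<epsilon>))
    (framing_le (caracol n) Minf Pinf (caracol_framing n \<epsilon>))
    (triangulations n p) (cambrian_le n p)"
proof (rule order_isomorphicI[OF bij_betw_maximal_cliques])
  interpret cambrian n \<epsilon> p by unfold_locales (rule assms(2))
  show "bij_betw (\<lambda>X. ends ` X - sides n p) (max_chord_cliques n \<epsilon>) (triangulations n p)"
    by (rule bij_betw_triangulations)
  fix X Y assume XY: "X \<in> max_chord_cliques n \<epsilon>" "Y \<in> max_chord_cliques n \<epsilon>"
  have q: "chord_step n \<epsilon> \<subseteq> max_chord_cliques n \<epsilon> \<times> max_chord_cliques n \<epsilon>"
    unfolding chord_step_def by blast
  \<comment> \<open>Single steps agree on the common index set, hence so do their
    reflexive-transitive closures.\<close>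
  have "(route ` X, route ` Y) \<in> framing_le (caracol n) Minf Pinf (caracol_framing n \<epsilon>) \<longleftrightarrow>
      (X, Y) \<in> (chord_step n \<epsilon>)\<^sup>*"
    unfolding framing_le_def
    by (rule rtrancl_image_iff[OF bij_betw_maximal_cliques _ q clique_step_iff XY])
      (auto simp: clique_step_def)
  also have "\<dots> \<longleftrightarrow> (ends ` X - sides n p, ends ` Y - sides n p) \<in> cambrian_le n p"
    unfolding cambrian_le_def
    by (rule rtrancl_image_iff[OF bij_betw_triangulations _ q increasing_flip_iff XY, symmetric])
      (auto simp: increasing_flip_def)
  finally show "(route ` X, route ` Y) \<in> framing_le (caracol n) Minf Pinf (caracol_framing n \<epsilon>) \<longleftrightarrow>
      (ends ` X - sides n p, ends ` Y - sides n p) \<in> cambrian_le n p" .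
qed

end
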